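(* Let $\alpha\in(0,1)$, $V_0\in\mathbb{R}$ and $K\ge V_0$. Let $$\mathcal{H}:=\left\{R\in\mathcal{R}_b^r:\ \int_0^1R(r)dr\le K\ \text{ and }\ \mathcal{V}(R)\ge V_0\right\},\qquad Q(\alpha):=\sup_{R\in\mathcal{H}}q_{\mathcal{E}(R)}(\alpha).$$ Then $Q(\alpha)$ is uniquely attained (up to a.e. equivalence) by the step function $$R^*(r)=V_0+\begin{cases}2c\sigma^2\ln\frac{\alpha}{x_\alpha},&0\le r<\alpha,\\[2pt]2c\sigma^2\ln\frac{1-\alpha}{1-x_\alpha},&\alpha\le r\le1,\end{cases}$$ where $x_\alpha$ is the unique solution in $[\alpha,1)$ of the equation $$\alpha\ln\frac{\alpha}{x}+(1-\alpha)\ln\frac{1-\alpha}{1-x}=\frac{K-V_0}{2c\sigma^2}.$$ Moreover, with $\mu^*=\mathcal{E}(R^* )$, $$Q(\alpha)=q_{\mu^*}(\alpha)=x_0+\sigma\sqrt{T}\,N^{-1}(x_\alpha),$$ and $\mu^*$ has density $$f_{\mu^*}(x)=\begin{cases}\frac{\alpha}{x_\alpha}f_0(x),&x<Q(\alpha),\\[2pt]\frac{1-\alpha}{1-x_\alpha}f_0(x),&x>Q(\alpha).\end{cases}$$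
   Context: Fix constants $T,\sigma,c>0$ and $x_0\in\mathbb{R}$. Let $f_0$ be the density of $\mathcal{N}(x_0,\sigma^2T)$ and $N$ the standard normal c.d.f. $\mathcal{R}_b^r$ is the set of bounded (weakly) increasing functions $R:[0,1]\to\mathbb{R}$ (bounded purely rank-based rewards). For a probability measure $\mu$ on $\mathbb{R}$, $q_\mu$ denotes its quantile function and $F_\mu$ its c.d.f. Game: let $\Omega=C([0,T],\mathbb{R})$ with canonical process $X$, and let $P$ be the law on $\Omega$ of $(x_0+\sigma B_t)_{t\in[0,T]}$, $B$ a standard Brownian motion started at $0$. Let $\mathcal{Q}$ be the set of probability measures $\mathbf{Q}$ on $\Omega$ with $\mathbf{Q}\sim P$ (mutually absolutely continuous), and write $\mathbf{Q}_T$ for the law of $X_T$ under $\mathbf{Q}$. With $H(\mathbf{Q}|P)=E^{\mathbf{Q}}[\ln(d\mathbf{Q}/dP)]$ the relative entropy, put for $\tilde\mu\in\mathcal{P}(\mathbb{R})$ $$V(R,\tilde\mu):=\sup_{\mathbf{Q}\in\mathcal{Q}}\left\{E^{\mathbf{Q}}\left[R(F_{\tilde\mu}(X_T))\right]-2c\sigma^2H(\mathbf{Q}|P)\right\}.$$ A probability measure $\mu$ on $\mathbb{R}$ is an equilibrium for $R$ if $\mu=\mathbf{Q}_T$ for some $\mathbf{Q}\in\mathcal{Q}$ attaining the supremum $V(R,\mu)$. Each $R\in\mathcal{R}_b^r$ has exactly one equilibrium, denoted $\mathcal{E}(R)$, and the game value is $\mathcal{V}(R):=V(R,\mathcal{E}(R))$.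 *)

theory Defs
  imports "HOL-Probability.Probability"
begin

definition standard_brownian_motion :: "real \<Rightarrow> 'a measure \<Rightarrow> (real \<Rightarrow> 'a \<Rightarrow> real) \<Rightarrow> bool" where
  "standard_brownian_motion T M B \<longleftrightarrow>
     prob_space M \<and>
     (\<forall>t\<in>{0..T}. B t \<in> borel_measurable M) \<and>
     (\<forall>\<omega>\<in>space M. B 0 \<omega> = 0) \<and>
     (\<forall>\<omega>\<in>space M. continuous_on {0..T} (\<lambda>t. B t \<omega>)) \<and>
     (\<forall>s t. 0 \<le> s \<and> s < t \<and> t \<le> T \<longrightarrow>
        distributed M lborel (\<lambda>\<omega>. B t \<omega> - B s \<omega>)
          (\<lambda>x. ennreal (normal_density 0 (sqrt (t - s)) x))) \<and>
     (\<forall>(n::nat) (t::nat \<Rightarrow> real). 0 \<le> t 0 \<and> (\<forall>i<n. t i \<le> t (Suc i)) \<and> t n \<le> T \<longrightarrow>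
        prob_space.indep_vars M (\<lambda>_. borel) (\<lambda>i \<omega>. B (t (Suc i)) \<omega> - B (t i) \<omega>) {..<n})"

text \<open>
  The space \<open>C([0,T], \<real>)\<close> with the sigma-algebra generated by the coordinates, which is the
  Borel sigma-algebra of the uniform norm. Paths are functions on the reals that are
  \<open>undefined\<close> outside \<open>[0,T]\<close>, so that distinct elements are distinct paths. Only the space and
  the sigma-algebra of this measure are used; the canonical process is \<open>X t \<omega> = \<omega> t\<close>.
\<close>
definition path_space :: "real \<Rightarrow> (real \<Rightarrow> real) measure" where
  "path_space T = restrict_space (PiM {0..T} (\<lambda>_. borel)) {\<omega>. continuous_on {0..T} \<omega>}"

definition path_law :: "real \<Rightarrow> 'a measure \<Rightarrow> (real \<Rightarrow> 'a \<Rightarrow> real) \<Rightarrow> (real \<Rightarrow> real) measure" where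
  "path_law T M Y = distr M (path_space T) (\<lambda>\<omega>. \<lambda>t\<in>{0..T}. Y t \<omega>)"

definition equivalent_probs :: "'a measure \<Rightarrow> 'a measure set" where
  "equivalent_probs P =
     {Q. prob_space Q \<and> sets Q = sets P \<and> absolutely_continuous P Q \<and> absolutely_continuous Q P}"

definition terminal_law :: "real \<Rightarrow> (real \<Rightarrow> real) measure \<Rightarrow> real measure" where
  "terminal_law T Q = distr Q borel (\<lambda>\<omega>. \<omega> T)"

text \<open>
  The library's \<^const>\<open>KL_divergence\<close> takes the reference measure first and is a Bochner integral,
  hence \<open>0\<close> if the log-density is not integrable. Its negative part is always integrable
  (as \<open>y ln y \<ge> - 1/e\<close>), so in that case the expectation is \<open>\<infinity>\<close>.
\<close>
definition relative_entropy :: "'a measure \<Rightarrow> 'a measure \<Rightarrow> ereal" where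
  "relative_entropy Q P =
     (if integrable Q (entropy_density (exp 1) P Q) then ereal (KL_divergence (exp 1) P Q) else \<infinity>)"

text \<open>Rewards are functions on \<open>[0,1]\<close>; values outside that interval are irrelevant.\<close>
definition rank_rewards :: "(real \<Rightarrow> real) set" where
  "rank_rewards = {R. mono_on {0..1} R \<and> bounded (R ` {0..1})}"

definition quantile :: "real measure \<Rightarrow> real \<Rightarrow> real" where
  "quantile \<mu> p = Inf {x. p \<le> cdf \<mu> x}"

definition payoff ::
  "real \<Rightarrow> real \<Rightarrow> real \<Rightarrow> (real \<Rightarrow> real) measure \<Rightarrow> (real \<Rightarrow> real) \<Rightarrow> real measure
     \<Rightarrow> (real \<Rightarrow> real) measure \<Rightarrow> ereal" where
  "payoff T c \<sigma> P R \<mu> Q =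
     ereal (\<integral>\<omega>. R (cdf \<mu> (\<omega> T)) \<partial>Q) - ereal (2 * c * \<sigma>\<^sup>2) * relative_entropy Q P"

definition best_value ::
  "real \<Rightarrow> real \<Rightarrow> real \<Rightarrow> (real \<Rightarrow> real) measure \<Rightarrow> (real \<Rightarrow> real) \<Rightarrow> real measure \<Rightarrow> ereal" where
  "best_value T c \<sigma> P R \<mu> = (SUP Q\<in>equivalent_probs P. payoff T c \<sigma> P R \<mu> Q)"

definition is_equilibrium ::
  "real \<Rightarrow> real \<Rightarrow> real \<Rightarrow> (real \<Rightarrow> real) measure \<Rightarrow> (real \<Rightarrow> real) \<Rightarrow> real measure \<Rightarrow> bool" where
  "is_equilibrium T c \<sigma> P R \<mu> \<longleftrightarrow>
     (\<exists>Q\<in>equivalent_probs P.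
        \<mu> = terminal_law T Q \<and> payoff T c \<sigma> P R \<mu> Q = best_value T c \<sigma> P R \<mu>)"

definition equilibrium ::
  "real \<Rightarrow> real \<Rightarrow> real \<Rightarrow> (real \<Rightarrow> real) measure \<Rightarrow> (real \<Rightarrow> real) \<Rightarrow> real measure" where
  "equilibrium T c \<sigma> P R = (THE \<mu>. is_equilibrium T c \<sigma> P R \<mu>)"

definition game_value ::
  "real \<Rightarrow> real \<Rightarrow> real \<Rightarrow> (real \<Rightarrow> real) measure \<Rightarrow> (real \<Rightarrow> real) \<Rightarrow> ereal" where
  "game_value T c \<sigma> P R = best_value T c \<sigma> P R (equilibrium T c \<sigma> P R)"

definition feasible_rewards ::
  "real \<Rightarrow> real \<Rightarrow> real \<Rightarrow> (real \<Rightarrow> real) measure \<Rightarrow> real \<Rightarrow> real \<Rightarrow> (real \<Rightarrow> real) set" where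
  "feasible_rewards T c \<sigma> P V0 K =
     {R \<in> rank_rewards. (LINT r:{0..1}|lborel. R r) \<le> K \<and> ereal V0 \<le> game_value T c \<sigma> P R}"

text \<open>The supremum is taken in \<^typ>\<open>ereal\<close>, so that its finiteness is part of any claim about it.\<close>
definition optimal_quantile ::
  "real \<Rightarrow> real \<Rightarrow> real \<Rightarrow> (real \<Rightarrow> real) measure \<Rightarrow> real \<Rightarrow> real \<Rightarrow> real \<Rightarrow> ereal" where
  "optimal_quantile T c \<sigma> P V0 K \<alpha> =
     (SUP R\<in>feasible_rewards T c \<sigma> P V0 K. ereal (quantile (equilibrium T c \<sigma> P R) \<alpha>))"

definition solves_level_equation ::
  "real \<Rightarrow> real \<Rightarrow> real \<Rightarrow> real \<Rightarrow> real \<Rightarrow> real \<Rightarrow> bool" where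
  "solves_level_equation c \<sigma> V0 K \<alpha> x \<longleftrightarrow>
     \<alpha> \<le> x \<and> x < 1 \<and>
     \<alpha> * ln (\<alpha> / x) + (1 - \<alpha>) * ln ((1 - \<alpha>) / (1 - x)) = (K - V0) / (2 * c * \<sigma>\<^sup>2)"

definition step_reward :: "real \<Rightarrow> real \<Rightarrow> real \<Rightarrow> real \<Rightarrow> real \<Rightarrow> real \<Rightarrow> real" where
  "step_reward c \<sigma> V0 \<alpha> x r =
     V0 + (if r < \<alpha> then 2 * c * \<sigma>\<^sup>2 * ln (\<alpha> / x)
           else 2 * c * \<sigma>\<^sup>2 * ln ((1 - \<alpha>) / (1 - x)))"

end

theory Submission
  imports Defs
begin

text \<open>
  Write \<open>\<beta> = 2 c \<sigma>\<^sup>2\<close>, let \<open>\<nu>\<close> be the law of the uncontrolled terminal value (here normal), with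
  distribution function \<open>F0\<close>, and put \<open>W u = \<integral>\<^sub>0\<^sup>u exp (- R r / \<beta>) dr\<close>.

  For a fixed population law \<open>\<mu>\<close>, a player maximises an expected reward minus \<open>\<beta>\<close> times a relative
  entropy, so the best response is the Gibbs tilt of \<open>P\<close> by \<open>exp (R (F\<^sub>\<mu> (X\<^sub>T)) / \<beta>)\<close>, it is the only one,
  and the optimal value is \<open>\<beta>\<close> times the log-partition function (\<open>payoff_gibbs\<close>). The tilt depends on the path
  only through \<open>X\<^sub>T\<close>, so \<open>\<mu>\<close> is an equilibrium iff it is the tilt of \<open>\<nu>\<close> by \<open>R \<circ> F\<^sub>\<mu> / \<beta>\<close>. This is a fixed
  point equation, but it becomes explicit when the tilt is inverted: \<open>\<nu>\<close> is the tilt of \<open>\<mu>\<close> by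
  \<open>- R \<circ> F\<^sub>\<mu> / \<beta>\<close>, and under \<open>\<mu>\<close> the rank \<open>F\<^sub>\<mu>\<close> is uniform on the unit interval. Hence the equation says
  \<open>F0 x = W (F\<^sub>\<mu> x) / W 1\<close> for all \<open>x\<close>, which determines \<open>F\<^sub>\<mu>\<close> because \<open>W\<close> is a strictly increasing continuous
  function (\<open>equilibrium_iff\<close>, \<open>equilibrium_unique\<close>). In particular the game value is \<open>- \<beta> ln (W 1)\<close>, and
  the \<open>\<alpha>\<close>-quantile \<open>q\<close> of the equilibrium satisfies \<open>F0 q = W \<alpha> / W 1\<close>.

  The design problem is therefore to maximise \<open>x = W \<alpha> / W 1\<close> subject to \<open>\<integral> R \<le> K\<close> and
  \<open>ln (W 1) \<le> - V0 / \<beta>\<close>. Jensen's inequality for the exponential on \<open>[0,\<alpha>]\<close> and on \<open>(\<alpha>,1]\<close> bounds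
  \<open>- \<integral> R / \<beta>\<close> from above by \<open>ln (W 1)\<close> minus the relative entropy of the two-point law \<open>(\<alpha>, 1 - \<alpha>)\<close> with
  respect to \<open>(x, 1 - x)\<close>. The two constraints thus bound that entropy by \<open>(K - V0) / \<beta>\<close>, and since it
  increases in \<open>x\<close> on \<open>[\<alpha>,1)\<close>, this means that \<open>x\<close> is at most the solution of the level equation. Equality
  forces equality in both applications of Jensen's inequality, that is, \<open>R\<close> is almost everywhere constant on each of
  the two pieces, with values fixed by \<open>x\<close> and by the binding participation constraint: \<open>R\<close> is the step
  reward (\<open>feasible_level_bound\<close>). Conversely the step reward meets both constraints with equality and
  attains the bound (\<open>step_reward_feasible\<close>).
\<close>

section \<open>The Gibbs variational principle\<close>

text \<open>
  The normalisation is built in, so that the tilting potential matters only up to an additive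
  constant.
\<close>
definition gibbs_measure :: "'a measure \<Rightarrow> ('a \<Rightarrow> real) \<Rightarrow> 'a measure" where
  "gibbs_measure P g = density P (\<lambda>x. ennreal (exp (g x) / (\<integral>y. exp (g y) \<partial>P)))"

lemma (in prob_space) partition_function:
  fixes g :: "'a \<Rightarrow> real"
  assumes [measurable]: "g \<in> borel_measurable M"
    and bound: "\<And>x. x \<in> space M \<Longrightarrow> \<bar>g x\<bar> \<le> C"
  shows "integrable M (\<lambda>x. exp (g x))" and "0 < (\<integral>x. exp (g x) \<partial>M)"
proof -
  show i: "integrable M (\<lambda>x. exp (g x))"
    using bound by (intro integrable_const_bound[where B="exp C"] AE_I2) (auto simp: abs_le_iff)
  have "exp (-C) = (\<integral>x. exp (-C) \<partial>M)"
    by (simp add: prob_space)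
  also have "\<dots> \<le> (\<integral>x. exp (g x) \<partial>M)"
    using bound by (intro integral_mono i) (auto simp: abs_le_iff minus_le_iff)
  finally show "0 < (\<integral>x. exp (g x) \<partial>M)"
    by (smt (verit) exp_gt_zero)
qed

lemma (in prob_space) gibbs_measure_equivalent:
  assumes [measurable]: "g \<in> borel_measurable M"
    and bound: "\<And>x. x \<in> space M \<Longrightarrow> \<bar>g x\<bar> \<le> C"
  shows "gibbs_measure M g \<in> equivalent_probs M"
proof -
  let ?Z = "\<integral>y. exp (g y) \<partial>M"
  note Z = partition_function[OF assms]
  have "emeasure (gibbs_measure M g) (space M) = (\<integral>\<^sup>+x. ennreal (exp (g x) / ?Z) \<partial>M)"
    by (simp add: gibbs_measure_def emeasure_density cong: nn_integral_cong)
  also have "\<dots> = ennreal (\<integral>x. exp (g x) / ?Z \<partial>M)"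
    using Z by (intro nn_integral_eq_integral) auto
  also have "\<dots> = 1" using Z by simp
  finally have "prob_space (gibbs_measure M g)"
    by (intro prob_spaceI) (simp add: gibbs_measure_def)
  moreover have "absolutely_continuous (gibbs_measure M g) M"
    unfolding absolutely_continuous_def
  proof
    fix A assume "A \<in> null_sets (gibbs_measure M g)"
    then have A: "A \<in> sets M" and "AE x in M. x \<in> A \<longrightarrow> ennreal (exp (g x) / ?Z) = 0"
      by (auto simp: gibbs_measure_def null_sets_density_iff)
    then have "AE x in M. x \<notin> A"
      using Z(2) by (auto simp: ennreal_eq_0_iff divide_le_0_iff not_less[symmetric])
    with A show "A \<in> null_sets M" by (simp add: AE_iff_null_sets)
  qed
  ultimately show ?thesis
    by (auto simp: equivalent_probs_def gibbs_measure_def intro!: absolutely_continuousI_density)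
qed

text \<open>
  With \<open>D = dQ/dP\<close> and \<open>Z\<close> the partition function, the gap in the inequality is the \<open>Q\<close>-integral of
  \<open>- ln t\<close> for \<open>t = exp g / (Z D)\<close>, and \<open>t\<close> has \<open>Q\<close>-integral \<open>1\<close>. So the gap is also the integral of
  \<open>t - 1 - ln t \<ge> 0\<close>, which vanishes only if \<open>t = 1\<close> almost everywhere, that is, \<open>D = exp g / Z\<close>.
\<close>
lemma (in prob_space) gibbs_inequality:
  assumes [measurable]: "g \<in> borel_measurable M"
    and bound: "\<And>x. x \<in> space M \<Longrightarrow> \<bar>g x\<bar> \<le> C"
    and Q: "Q \<in> equivalent_probs M"
    and int: "integrable Q (entropy_density (exp 1) M Q)"
  shows "(\<integral>x. g x \<partial>Q) - KL_divergence (exp 1) M Q \<le> ln (\<integral>x. exp (g x) \<partial>M)"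
    and "(\<integral>x. g x \<partial>Q) - KL_divergence (exp 1) M Q = ln (\<integral>x. exp (g x) \<partial>M) \<longleftrightarrow>
      Q = gibbs_measure M g"
proof -
  let ?Z = "\<integral>y. exp (g y) \<partial>M"
  note Z = partition_function[OF assms(1,2), simplified]
  interpret Q: prob_space Q using Q by (simp add: equivalent_probs_def)
  have [measurable_cong, simp]: "sets Q = sets M" and acMQ: "absolutely_continuous M Q"
    and acQM: "absolutely_continuous Q M"
    using Q by (auto simp: equivalent_probs_def)
  have sp: "space Q = space M" using sets_eq_imp_space_eq[of Q M] by simp
  obtain D where D[measurable]: "D \<in> borel_measurable M"
    and RN: "AE x in M. RN_deriv M Q x = ennreal (D x)"
    and pos: "AE x in Q. 0 < D x" and nn: "\<And>x. 0 \<le> D x"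
    using real_RN_deriv[OF Q.finite_measure_axioms acMQ] by auto
  have posM: "AE x in M. 0 < D x"
    using absolutely_continuous_AE[OF _ acQM pos] by simp
  have RNQ: "AE x in Q. RN_deriv M Q x = ennreal (D x)"
    using absolutely_continuous_AE[OF _ acMQ RN] by simp
  have Q_eq: "Q = density M (\<lambda>x. ennreal (D x))"
    using density_RN_deriv[OF acMQ] density_cong[OF _ _ RN] by simp
  have ent: "AE x in Q. entropy_density (exp 1) M Q x = ln (D x)"
    using RNQ by eventually_elim (simp add: entropy_density_def log_def nn)
  have [measurable]: "entropy_density (exp 1) M Q \<in> borel_measurable Q" using int by auto
  have intD: "integrable Q (\<lambda>x. ln (D x))"
    using int by (rule integrable_cong_AE_imp) (use ent in auto)
  have KL: "KL_divergence (exp 1) M Q = (\<integral>x. ln (D x) \<partial>Q)"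
    unfolding KL_divergence_def by (rule integral_cong_AE) (use ent in auto)
  have intg: "integrable Q g"
    using bound by (intro Q.integrable_const_bound[where B=C] AE_I2) (auto simp: sp)
  define t where "t x = exp (g x) / (?Z * D x)" for x
  have [measurable]: "t \<in> borel_measurable M" unfolding t_def by simp
  have Dt: "AE x in M. D x * t x = exp (g x) / ?Z"
    using posM by eventually_elim (auto simp: t_def field_simps)
  have "integrable M (\<lambda>x. D x * t x)"
    by (rule integrable_cong_AE_imp[of _ "\<lambda>x. exp (g x) / ?Z"]) (use Z Dt in \<open>auto elim: eventually_mono\<close>)
  then have intt: "integrable Q t"
    unfolding Q_eq by (subst integrable_density) (auto simp: nn)
  have "(\<integral>x. t x \<partial>Q) = (\<integral>x. D x * t x \<partial>M)"
    unfolding Q_eq by (subst integral_density) (auto simp: nn)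
  also have "\<dots> = (\<integral>x. exp (g x) / ?Z \<partial>M)"
    by (rule integral_cong_AE) (use Dt in auto)
  finally have t1: "(\<integral>x. t x \<partial>Q) = 1" using Z by simp
  have lnt: "AE x in Q. ln (t x) = g x - ln (D x) - ln ?Z"
    using pos by eventually_elim (use Z in \<open>simp add: t_def ln_div ln_mult\<close>)
  have tpos: "AE x in Q. 0 < t x"
    using pos by eventually_elim (use Z in \<open>simp add: t_def\<close>)
  define gap where "gap x = t x - 1 - (g x - ln (D x) - ln ?Z)" for x
  have [measurable]: "gap \<in> borel_measurable M" unfolding gap_def by simp
  have gap_nn: "AE x in Q. 0 \<le> gap x"
    using lnt tpos by eventually_elim (metis gap_def ln_le_minus_one diff_ge_0_iff_ge)
  have gap_int: "integrable Q gap" unfolding gap_def using intt intg intD by auto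
  have gap_eq: "(\<integral>x. gap x \<partial>Q) = ln ?Z - ((\<integral>x. g x \<partial>Q) - KL_divergence (exp 1) M Q)"
    unfolding gap_def using intt intg intD by (simp add: KL t1 Q.prob_space)
  show "(\<integral>x. g x \<partial>Q) - KL_divergence (exp 1) M Q \<le> ln ?Z"
    using integral_nonneg_AE[OF gap_nn] gap_eq by simp
  have "(\<integral>x. g x \<partial>Q) - KL_divergence (exp 1) M Q = ln ?Z \<longleftrightarrow> (\<integral>x. gap x \<partial>Q) = 0"
    using gap_eq by auto
  also have "\<dots> \<longleftrightarrow> (AE x in Q. gap x = 0)"
    by (rule integral_nonneg_eq_0_iff_AE[OF gap_int gap_nn])
  also have "\<dots> \<longleftrightarrow> (AE x in Q. D x = exp (g x) / ?Z)"
  proof -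
    have "AE x in Q. gap x = 0 \<longleftrightarrow> D x = exp (g x) / ?Z"
      using lnt tpos pos
    proof eventually_elim
      case (elim x)
      have "gap x = 0 \<longleftrightarrow> t x = 1"
        using elim ln_eq_minus_one[of "t x"] by (auto simp: gap_def)
      also have "\<dots> \<longleftrightarrow> D x = exp (g x) / ?Z"
        using elim Z by (auto simp: t_def field_simps)
      finally show ?case .
    qed
    then show ?thesis by (rule eventually_subst)
  qed
  also have "\<dots> \<longleftrightarrow> (AE x in M. D x = exp (g x) / ?Z)"
    using absolutely_continuous_AE[OF _ acQM] absolutely_continuous_AE[OF _ acMQ] by auto
  also have "\<dots> \<longleftrightarrow> (AE x in M. ennreal (D x) = ennreal (exp (g x) / ?Z))"
    using Z nn by (intro arg_cong2[where f=eventually] refl ext) simp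
  also have "\<dots> \<longleftrightarrow> Q = gibbs_measure M g"
    unfolding Q_eq gibbs_measure_def by (rule density_unique_iff[symmetric]) auto
  finally show "(\<integral>x. g x \<partial>Q) - KL_divergence (exp 1) M Q = ln ?Z \<longleftrightarrow> Q = gibbs_measure M g" .
qed

text \<open>
  Its log-density is \<open>g\<close> minus a constant, hence bounded. This makes the optimum in
  \<open>gibbs_inequality\<close> an admissible competitor with finite entropy.
\<close>
lemma (in prob_space) gibbs_measure_finite_entropy:
  assumes [measurable]: "g \<in> borel_measurable M"
    and bound: "\<And>x. x \<in> space M \<Longrightarrow> \<bar>g x\<bar> \<le> C"
  shows "integrable (gibbs_measure M g) (entropy_density (exp 1) M (gibbs_measure M g))"
proof -
  let ?Z = "\<integral>y. exp (g y) \<partial>M" and ?Q = "gibbs_measure M g"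
  note Z = partition_function[OF assms]
  have Q: "?Q \<in> equivalent_probs M" by (rule gibbs_measure_equivalent[OF assms])
  then interpret Q: prob_space ?Q by (simp add: equivalent_probs_def)
  have [measurable_cong, simp]: "sets ?Q = sets M" and acMQ: "absolutely_continuous M ?Q"
    using Q by (auto simp: equivalent_probs_def)
  have sp: "space ?Q = space M" by (simp add: gibbs_measure_def)
  have "AE x in M. ennreal (exp (g x) / ?Z) = RN_deriv M ?Q x"
    by (rule RN_deriv_unique) (auto simp: gibbs_measure_def)
  then have "AE x in ?Q. ennreal (exp (g x) / ?Z) = RN_deriv M ?Q x"
    by (rule absolutely_continuous_AE[OF _ acMQ, rotated]) simp
  then have ent: "AE x in ?Q. g x - ln ?Z = entropy_density (exp 1) M ?Q x"
  proof eventually_elim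
    case (elim x)
    have "enn2real (RN_deriv M ?Q x) = exp (g x) / ?Z"
      unfolding elim[symmetric] using Z by simp
    then show ?case
      using Z by (simp add: entropy_density_def log_def ln_div)
  qed
  have m: "entropy_density (exp 1) M ?Q \<in> borel_measurable ?Q"
    using measurable_entropy_density by (simp cong: measurable_cong_sets)
  have "integrable ?Q g"
    using bound by (intro Q.integrable_const_bound[where B=C] AE_I2) (auto simp: sp)
  then show ?thesis
    by (intro integrable_cong_AE_imp[OF _ m ent]) simp
qed

text \<open>
  Tilting back by \<open>- g\<close>. This is what turns the fixed point equation for an equilibrium, in which the
  unknown law occurs inside the tilt of a known law, into a formula for the known law.
\<close>
lemma (in prob_space) gibbs_measure_inverse:
  fixes g :: "'a \<Rightarrow> real"
  assumes [measurable]: "g \<in> borel_measurable M"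
    and bound: "\<And>x. x \<in> space M \<Longrightarrow> \<bar>g x\<bar> \<le> C"
  shows "gibbs_measure (gibbs_measure M g) (\<lambda>x. - g x) = M"
    and "(\<integral>x. exp (- g x) \<partial>gibbs_measure M g) = 1 / (\<integral>x. exp (g x) \<partial>M)"
proof -
  let ?Z = "\<integral>y. exp (g y) \<partial>M"
  note Z = partition_function[OF assms, simplified]
  show inv: "(\<integral>x. exp (- g x) \<partial>gibbs_measure M g) = 1 / ?Z"
    using Z unfolding gibbs_measure_def
    by (subst integral_density) (auto simp: exp_minus prob_space intro!: AE_I2)
  have "gibbs_measure (gibbs_measure M g) (\<lambda>x. - g x)
      = density M (\<lambda>x. ennreal (exp (g x) / ?Z) * ennreal (exp (- g x) / (1 / ?Z)))"
    unfolding gibbs_measure_def[of "gibbs_measure M g"] inv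
    unfolding gibbs_measure_def by (rule density_density_eq) auto
  also have "\<dots> = density M (\<lambda>_. 1)"
    using Z by (intro density_cong) (auto simp: exp_minus simp flip: ennreal_mult)
  finally show "gibbs_measure (gibbs_measure M g) (\<lambda>x. - g x) = M"
    by (simp add: density_1)
qed

lemma distr_gibbs_measure:
  fixes g :: "'b \<Rightarrow> real"
  assumes [measurable]: "X \<in> measurable M N" "g \<in> borel_measurable N"
  shows "distr (gibbs_measure M (\<lambda>\<omega>. g (X \<omega>))) N X = gibbs_measure (distr M N X) g"
proof -
  have "(\<integral>x. exp (g x) \<partial>distr M N X) = (\<integral>\<omega>. exp (g (X \<omega>)) \<partial>M)"
    by (rule integral_distr) auto
  then show ?thesis
    unfolding gibbs_measure_def by (subst density_distr) auto
qed


section \<open>Integrating functions of the rank\<close>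

lemma cdf_in_unit: "real_distribution \<mu> \<Longrightarrow> cdf \<mu> x \<in> {0..1}"
  by (simp add: real_distribution.cdf_bounded_prob finite_borel_measure.cdf_nonneg real_distribution.finite_borel_measure_M)

text \<open>
  The Galois connection between quantile and distribution function gives \<open>p \<le> F (q p)\<close>; it also gives
  \<open>F y < p\<close> to the left of the quantile, and continuity carries this bound to the quantile itself.
\<close>
lemma cdf_quantile:
  assumes \<mu>: "real_distribution \<mu>" and no_atoms: "\<And>x. isCont (cdf \<mu>) x" and p: "0 < p" "p < 1"
  shows "cdf \<mu> (quantile \<mu> p) = p"
proof -
  interpret \<mu>: cdf_distribution \<mu> using \<mu> by (simp add: cdf_distribution_def)
  let ?q = "quantile \<mu> p"
  have inv: "p \<le> cdf \<mu> y \<longleftrightarrow> ?q \<le> y" for y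
    using \<mu>.pseudoinverse[OF p, of y] by (simp only: quantile_def)
  show ?thesis
  proof (rule antisym)
    show "p \<le> cdf \<mu> ?q" using inv by simp
    have "(cdf \<mu> \<longlongrightarrow> cdf \<mu> ?q) (at_left ?q)"
      using no_atoms[of ?q] by (simp add: isCont_def filterlim_at_split)
    moreover have "eventually (\<lambda>y. cdf \<mu> y \<le> p) (at_left ?q)"
    proof (rule eventually_at_leftI[of "?q - 1"])
      fix y assume "y \<in> {?q - 1<..<?q}"
      then have "\<not> p \<le> cdf \<mu> y" by (simp only: inv) simp
      then show "cdf \<mu> y \<le> p" by simp
    qed simp
    ultimately show "cdf \<mu> ?q \<le> p" by (intro tendsto_upperbound) auto
  qed
qed

text \<open>
  The probability integral transform: \<open>\<mu>\<close> is the image of the uniform law under its quantile function \<open>q\<close>,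
  and \<open>F (q u) = u\<close> when \<open>F\<close> is continuous. Restricting to \<open>{..x}\<close> amounts to restricting the rank to
  \<open>{..F x}\<close>, because \<open>q u \<le> x\<close> holds iff \<open>u \<le> F x\<close>.
\<close>
lemma rank_integral_eq:
  fixes h :: "real \<Rightarrow> real"
  assumes \<mu>: "real_distribution \<mu>" and no_atoms: "\<And>x. isCont (cdf \<mu>) x"
    and h: "h \<in> borel_measurable (restrict_space borel {0..1})"
  shows "(\<integral>y. indicator {..x} y * h (cdf \<mu> y) \<partial>\<mu>) = (LINT r:{0..cdf \<mu> x}|lborel. h r)"
    and "(\<integral>y. h (cdf \<mu> y) \<partial>\<mu>) = (LINT r:{0..1}|lborel. h r)"
proof -
  interpret cdf_distribution \<mu> using \<mu> by (simp add: cdf_distribution_def)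
  \<comment> \<open>Ranks lie in the unit interval, so \<open>h\<close> can be cut off there, which makes it Borel on the whole line.\<close>
  define h0 where "h0 r = indicator {0..1} r * h r" for r :: real
  have [measurable]: "h0 \<in> borel_measurable borel"
    using h unfolding h0_def by (subst (asm) borel_measurable_restrict_space_iff) auto
  have h0: "h (C y) = h0 (C y)" for y
    using cdf_in_unit[OF \<mu>] by (simp add: h0_def)
  have CI: "C (I u) = u" if "0 < u" "u < 1" for u
    using cdf_quantile[OF \<mu> no_atoms that] by (simp only: quantile_def)
  have key: "(\<integral>y. \<phi> y * h (C y) \<partial>\<mu>) = (\<integral>u. indicator {0<..<1} u *\<^sub>R (\<phi> (I u) * h0 u) \<partial>lborel)"
    if [measurable]: "\<phi> \<in> borel_measurable borel" for \<phi> :: "real \<Rightarrow> real"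
  proof -
    have "sets (restrict_space lborel {0<..<1::real}) = sets (restrict_space borel {0<..<1})"
      by (simp add: sets_restrict_space)
    then have [measurable]: "I \<in> borel_measurable (restrict_space lborel {0<..<1})"
      using measurable_CI by (subst measurable_cong_sets) (assumption | rule refl)+
    have "(\<integral>y. \<phi> y * h (C y) \<partial>\<mu>) = (\<integral>y. \<phi> y * h0 (C y) \<partial>distr (restrict_space lborel {0<..<1}) borel I)"
      by (simp add: h0 distr_I_eq_M)
    also have "\<dots> = (\<integral>u. \<phi> (I u) * h0 (C (I u)) \<partial>restrict_space lborel {0<..<1})"
      by (rule integral_distr) auto
    also have "\<dots> = (\<integral>u. indicator {0<..<1} u *\<^sub>R (\<phi> (I u) * h0 (C (I u))) \<partial>lborel)"
      by (rule integral_restrict_space) auto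
    also have "\<dots> = (\<integral>u. indicator {0<..<1} u *\<^sub>R (\<phi> (I u) * h0 u) \<partial>lborel)"
      by (intro Bochner_Integration.integral_cong refl) (auto simp: CI split: split_indicator)
    finally show ?thesis .
  qed
  have ae: "AE u in lborel. u \<noteq> 0 \<and> u \<noteq> (1::real)"
    using AE_lborel_singleton[of 0] AE_lborel_singleton[of 1] by eventually_elim auto
  have set_h: "set_borel_measurable lborel S h" if "S \<in> sets borel" "S \<subseteq> {0..1}" for S
  proof -
    have "(\<lambda>r. indicator S r * h0 r) \<in> borel_measurable lborel"
      using that by measurable
    also have "(\<lambda>r. indicator S r * h0 r) = (\<lambda>r. indicator S r *\<^sub>R h r)"
      using that by (auto simp: h0_def fun_eq_iff split: split_indicator)
    finally show ?thesis by (simp add: set_borel_measurable_def)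
  qed
  have I01: "{0..C x} \<subseteq> {0..1}" for x using cdf_in_unit[OF \<mu>, of x] by auto
  have "(\<integral>y. indicator {..x} y * h (C y) \<partial>\<mu>)
      = (\<integral>u. indicator {0<..<1} u *\<^sub>R (indicator {..x} (I u) * h0 u) \<partial>lborel)"
    by (rule key) auto
  also have "\<dots> = (\<integral>u. indicator {0<..<1} u *\<^sub>R (indicator {..C x} u * h0 u) \<partial>lborel)"
  proof (intro Bochner_Integration.integral_cong refl)
    fix u
    have "0 < u \<Longrightarrow> u < 1 \<Longrightarrow> I u \<le> x \<longleftrightarrow> u \<le> C x" using pseudoinverse by blast
    then show "indicator {0<..<1} u *\<^sub>R (indicator {..x} (I u) * h0 u)
        = indicator {0<..<1} u *\<^sub>R (indicator {..C x} u * h0 u)"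
      by (auto split: split_indicator)
  qed
  also have "\<dots> = (LINT r:{0..C x}|lborel. h r)"
    unfolding set_lebesgue_integral_def
  proof (rule integral_cong_AE)
    show "AE u in lborel. indicator {0<..<1} u *\<^sub>R (indicator {..C x} u * h0 u) = indicator {0..C x} u *\<^sub>R h u"
      using ae
    proof eventually_elim
      case (elim u)
      then show ?case using I01[of x] by (auto simp: h0_def indicator_def)
    qed
    show "(\<lambda>u. indicator {0..C x} u *\<^sub>R h u) \<in> borel_measurable lborel"
      using set_h[of "{0..C x}"] I01[of x] unfolding set_borel_measurable_def by simp
  qed measurable
  finally show "(\<integral>y. indicator {..x} y * h (cdf \<mu> y) \<partial>\<mu>) = (LINT r:{0..cdf \<mu> x}|lborel. h r)" .
  have "(\<integral>y. h (C y) \<partial>\<mu>) = (\<integral>u. indicator {0<..<1} u *\<^sub>R h0 u \<partial>lborel)"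
    using key[of "\<lambda>_. 1"] by simp
  also have "\<dots> = (LINT r:{0..1}|lborel. h r)"
    unfolding set_lebesgue_integral_def
  proof (rule integral_cong_AE)
    show "AE u in lborel. indicator {0<..<1} u *\<^sub>R h0 u = indicator {0..1} u *\<^sub>R h u"
      using ae by eventually_elim (auto simp: h0_def indicator_def)
    show "(\<lambda>u. indicator {0..1} u *\<^sub>R h u) \<in> borel_measurable lborel"
      using set_h[of "{0..1}"] unfolding set_borel_measurable_def by simp
  qed measurable
  finally show "(\<integral>y. h (cdf \<mu> y) \<partial>\<mu>) = (LINT r:{0..1}|lborel. h r)" .
qed

lemma set_integrable_bounded:
  fixes h :: "real \<Rightarrow> real"
  assumes h: "h \<in> borel_measurable (restrict_space borel {0..1})"
    and bound: "\<And>r. r \<in> {0..1} \<Longrightarrow> \<bar>h r\<bar> \<le> C"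
    and S: "S \<in> sets borel" "S \<subseteq> {0..1}"
  shows "set_integrable lborel S h"
proof -
  have "set_integrable lborel {0..1} h"
    unfolding set_integrable_def
  proof (rule integrableI_bounded_set[where A="{0..1}" and B=C])
    show "(\<lambda>r. indicator {0..1} r *\<^sub>R h r) \<in> borel_measurable lborel"
      using h by (subst (asm) borel_measurable_restrict_space_iff) auto
  qed (use bound in auto)
  then show ?thesis by (rule set_integrable_subset) (use S in auto)
qed

lemma rank_rewardsE:
  assumes "R \<in> rank_rewards"
  obtains C where "\<And>r. r \<in> {0..1} \<Longrightarrow> \<bar>R r\<bar> \<le> C" and "R \<in> borel_measurable (restrict_space borel {0..1})"
proof -
  have R: "mono_on {0..1} R" "bounded (R ` {0..1})"
    using assms by (auto simp: rank_rewards_def)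
  obtain C where "\<forall>r\<in>{0..1}. \<bar>R r\<bar> \<le> C"
    using R(2) by (auto simp: bounded_iff)
  then show ?thesis
    using borel_measurable_mono_on_fnc[OF R(1)] that by blast
qed

lemma reward_of_rank:
  assumes R: "R \<in> rank_rewards" and \<mu>: "real_distribution \<mu>"
  shows "(\<lambda>x. R (cdf \<mu> x)) \<in> borel_measurable borel" and "\<exists>C. \<forall>x. \<bar>R (cdf \<mu> x)\<bar> \<le> C"
proof -
  interpret cdf_distribution \<mu> using \<mu> by (simp add: cdf_distribution_def)
  obtain C where C: "\<And>r. r \<in> {0..1} \<Longrightarrow> \<bar>R r\<bar> \<le> C" "R \<in> borel_measurable (restrict_space borel {0..1})"
    using rank_rewardsE[OF R] by blast
  have "cdf \<mu> \<in> measurable borel (restrict_space borel {0..1})"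
    using cdf_in_unit[OF \<mu>] by (intro measurable_restrict_space2) auto
  from measurable_compose[OF this C(2)] show "(\<lambda>x. R (cdf \<mu> x)) \<in> borel_measurable borel" .
  show "\<exists>C. \<forall>x. \<bar>R (cdf \<mu> x)\<bar> \<le> C" using C cdf_in_unit[OF \<mu>] by blast
qed

text \<open>
  Up to normalisation this is the mass under the reference law of the terminal values whose equilibrium
  rank is at most \<open>u\<close>: at rank \<open>r\<close> the equilibrium has density proportional to \<open>exp (R r / \<beta>)\<close> with respect to
  the reference law, and the equilibrium ranks are uniform.
\<close>
definition discounted_length :: "real \<Rightarrow> (real \<Rightarrow> real) \<Rightarrow> real \<Rightarrow> real" where
  "discounted_length \<beta> R u = (LINT r:{0..u}|lborel. exp (- R r / \<beta>))"

lemma exp_reward_bounds: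
  assumes R: "R \<in> rank_rewards" and \<beta>: "0 < \<beta>"
  obtains m L where "0 < m" "\<And>r. r \<in> {0..1} \<Longrightarrow> m \<le> exp (- R r / \<beta>)" "\<And>r. r \<in> {0..1} \<Longrightarrow> exp (- R r / \<beta>) \<le> L"
    "(\<lambda>r. exp (- R r / \<beta>)) \<in> borel_measurable (restrict_space borel {0..1})"
proof -
  obtain C where C: "\<And>r. r \<in> {0..1} \<Longrightarrow> \<bar>R r\<bar> \<le> C" and m[measurable]: "R \<in> borel_measurable (restrict_space borel {0..1})"
    using rank_rewardsE[OF R] by blast
  have *: "- C / \<beta> \<le> - R r / \<beta> \<and> - R r / \<beta> \<le> C / \<beta>" if "r \<in> {0..1}" for r
    using C[OF that] \<beta> by (intro conjI divide_right_mono) auto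
  show ?thesis
    by (rule that[of "exp (- C / \<beta>)" "exp (C / \<beta>)"]) (use * in auto)
qed

lemma exp_reward_integrable:
  assumes R: "R \<in> rank_rewards" and \<beta>: "0 < \<beta>" and S: "S \<in> sets borel" "S \<subseteq> {0..1}"
  shows "set_integrable lborel S (\<lambda>r. exp (- R r / \<beta>))"
proof -
  obtain m L where *: "\<And>r. r \<in> {0..1} \<Longrightarrow> exp (- R r / \<beta>) \<le> L"
    "(\<lambda>r. exp (- R r / \<beta>)) \<in> borel_measurable (restrict_space borel {0..1})"
    using exp_reward_bounds[OF R \<beta>] by metis
  show ?thesis by (rule set_integrable_bounded[OF *(2) _ S, of L]) (use * in auto)
qed

lemma discounted_length_split:
  assumes R: "R \<in> rank_rewards" and \<beta>: "0 < \<beta>" and uv: "0 \<le> u" "u \<le> v" "v \<le> 1"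
  shows "discounted_length \<beta> R v = discounted_length \<beta> R u + (LINT r:{u<..v}|lborel. exp (- R r / \<beta>))"
proof -
  have "{0..v} = {0..u} \<union> {u<..v}" using uv by auto
  then show ?thesis
    unfolding discounted_length_def
    by (simp only:) (intro set_integral_Un exp_reward_integrable R \<beta>; use uv in auto)
qed

text \<open>
  A bounded reward keeps the integrand between two positive constants, so \<open>discounted_length\<close> is
  bi-Lipschitz. Strict monotonicity and continuity follow from the two bounds.
\<close>
lemma discounted_length_bounds:
  assumes R: "R \<in> rank_rewards" and \<beta>: "0 < \<beta>"
  obtains m L where "0 < m"
    "\<And>u v. 0 \<le> u \<Longrightarrow> u \<le> v \<Longrightarrow> v \<le> 1 \<Longrightarrow>
      m * (v - u) \<le> discounted_length \<beta> R v - discounted_length \<beta> R u"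
    "\<And>u v. 0 \<le> u \<Longrightarrow> u \<le> v \<Longrightarrow> v \<le> 1 \<Longrightarrow>
      discounted_length \<beta> R v - discounted_length \<beta> R u \<le> L * (v - u)"
proof -
  obtain m L where *: "0 < m" "\<And>r. r \<in> {0..1} \<Longrightarrow> m \<le> exp (- R r / \<beta>)" "\<And>r. r \<in> {0..1} \<Longrightarrow> exp (- R r / \<beta>) \<le> L"
    using exp_reward_bounds[OF R \<beta>] by metis
  have const: "set_integrable lborel {u<..v} (\<lambda>_. k)" "(LINT r:{u<..v}|lborel. k) = k * (v - u)"
    if "u \<le> v" for u v k :: real
    using that by (auto simp: set_integrable_def set_lebesgue_integral_def)
  show ?thesis
  proof (rule that[OF *(1)])
    fix u v :: real assume uv: "0 \<le> u" "u \<le> v" "v \<le> 1"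
    have i: "set_integrable lborel {u<..v} (\<lambda>r. exp (- R r / \<beta>))"
      using uv by (intro exp_reward_integrable R \<beta>) auto
    have "(LINT r:{u<..v}|lborel. m) \<le> (LINT r:{u<..v}|lborel. exp (- R r / \<beta>))"
      using uv * by (intro set_integral_mono const i) auto
    then show "m * (v - u) \<le> discounted_length \<beta> R v - discounted_length \<beta> R u"
      using discounted_length_split[OF R \<beta> uv] const(2)[OF uv(2)] by simp
    have "(LINT r:{u<..v}|lborel. exp (- R r / \<beta>)) \<le> (LINT r:{u<..v}|lborel. L)"
      using uv * by (intro set_integral_mono const i) auto
    then show "discounted_length \<beta> R v - discounted_length \<beta> R u \<le> L * (v - u)"
      using discounted_length_split[OF R \<beta> uv] const(2)[OF uv(2)] by simp
  qed
qed

lemma discounted_length_0 [simp]: "discounted_length \<beta> R 0 = 0"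
  using AE_lborel_singleton[of 0]
  unfolding discounted_length_def set_lebesgue_integral_def
  by (intro integral_eq_zero_AE) (auto elim!: eventually_mono)

lemma discounted_length_strict_mono:
  assumes R: "R \<in> rank_rewards" and \<beta>: "0 < \<beta>" and uv: "0 \<le> u" "u < v" "v \<le> 1"
  shows "discounted_length \<beta> R u < discounted_length \<beta> R v"
proof -
  obtain m where m: "0 < m" "m * (v - u) \<le> discounted_length \<beta> R v - discounted_length \<beta> R u"
    by (rule discounted_length_bounds[OF R \<beta>]) (use uv in auto)
  then show ?thesis using uv mult_pos_pos[of m "v - u"] by linarith
qed

lemma discounted_length_inj:
  assumes R: "R \<in> rank_rewards" and \<beta>: "0 < \<beta>"
  shows "inj_on (discounted_length \<beta> R) {0..1}"
proof (rule linorder_inj_onI)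
  fix u v :: real assume "u < v" "u \<in> {0..1}" "v \<in> {0..1}"
  then show "discounted_length \<beta> R u \<noteq> discounted_length \<beta> R v"
    using discounted_length_strict_mono[OF R \<beta>, of u v] by simp
qed auto

lemma discounted_length_continuous:
  assumes R: "R \<in> rank_rewards" and \<beta>: "0 < \<beta>"
  shows "continuous_on {0..1} (discounted_length \<beta> R)"
proof -
  obtain m L where m: "0 < m" and L: "\<And>u v. 0 \<le> u \<Longrightarrow> u \<le> v \<Longrightarrow> v \<le> 1 \<Longrightarrow>
      m * (v - u) \<le> discounted_length \<beta> R v - discounted_length \<beta> R u"
      "\<And>u v. 0 \<le> u \<Longrightarrow> u \<le> v \<Longrightarrow> v \<le> 1 \<Longrightarrow>
      discounted_length \<beta> R v - discounted_length \<beta> R u \<le> L * (v - u)"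
    by (rule discounted_length_bounds[OF R \<beta>]) blast
  have half: "\<bar>discounted_length \<beta> R v - discounted_length \<beta> R u\<bar> \<le> L * \<bar>v - u\<bar>"
    if "0 \<le> u" "u \<le> v" "v \<le> 1" for u v
  proof -
    have "0 \<le> m * (v - u)" using m that by simp
    with L[OF that] that show ?thesis by linarith
  qed
  have "L-lipschitz_on {0..1} (discounted_length \<beta> R)"
  proof (rule lipschitz_onI)
    show "0 \<le> L" using L[of 0 1] m by simp
    fix u v :: real assume "u \<in> {0..1}" "v \<in> {0..1}"
    then show "dist (discounted_length \<beta> R u) (discounted_length \<beta> R v) \<le> L * dist u v"
      using half[of u v] half[of v u] by (cases "u \<le> v") (auto simp: dist_real_def abs_minus_commute)
  qed
  then show ?thesis by (rule lipschitz_on_continuous_on)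
qed

lemma discounted_length_1_pos:
  assumes R: "R \<in> rank_rewards" and \<beta>: "0 < \<beta>"
  shows "0 < discounted_length \<beta> R 1"
  using discounted_length_strict_mono[OF assms, of 0 1] by simp

text \<open>
  The rank is uniform under \<open>\<mu>\<close>, so integrals of functions of the rank reduce to Lebesgue integrals.
  When \<open>\<mu>\<close> is an equilibrium for \<open>R\<close>, the law on the left is the reference law.
\<close>
lemma cdf_inverse_gibbs:
  assumes \<mu>: "real_distribution \<mu>" and no_atoms: "\<And>x. isCont (cdf \<mu>) x"
    and R: "R \<in> rank_rewards" and \<beta>: "0 < \<beta>"
  shows "cdf (gibbs_measure \<mu> (\<lambda>y. - (R (cdf \<mu> y) / \<beta>))) x
      = discounted_length \<beta> R (cdf \<mu> x) / discounted_length \<beta> R 1"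
proof -
  interpret \<mu>: real_distribution \<mu> by fact
  note [measurable] = reward_of_rank(1)[OF R \<mu>]
  let ?h = "\<lambda>r. exp (- R r / \<beta>)"
  have h: "?h \<in> borel_measurable (restrict_space borel {0..1})"
    using exp_reward_bounds[OF R \<beta>] by metis
  note rank = rank_integral_eq[OF \<mu> no_atoms h, folded discounted_length_def]
  let ?Q = "gibbs_measure \<mu> (\<lambda>y. - (R (cdf \<mu> y) / \<beta>))"
  have "cdf ?Q x = (\<integral>y. indicator {..x} y \<partial>?Q)"
    by (simp add: cdf_def gibbs_measure_def)
  also have "\<dots> = (\<integral>y. indicator {..x} y * ?h (cdf \<mu> y) / discounted_length \<beta> R 1 \<partial>\<mu>)"
    unfolding gibbs_measure_def using discounted_length_1_pos[OF R \<beta>]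
    by (subst integral_density) (auto simp: rank(2)[symmetric] mult_ac)
  also have "\<dots> = discounted_length \<beta> R (cdf \<mu> x) / discounted_length \<beta> R 1"
    using rank(1)[of x] by simp
  finally show ?thesis .
qed

text \<open>
  The distribution function is \<open>V (W 1 * F0 x)\<close>, where \<open>V\<close> is the inverse of \<open>W\<close> on \<open>[0,1]\<close>. It is continuous
  as the inverse of a continuous injection on a compact interval, and it inherits monotonicity and the
  limits \<open>0\<close> and \<open>1\<close> from \<open>F0\<close>.
\<close>
lemma rank_cdf_exists:
  assumes R: "R \<in> rank_rewards" and \<beta>: "0 < \<beta>"
    and \<nu>: "real_distribution \<nu>" and no_atoms: "\<And>x. isCont (cdf \<nu>) x"
  obtains \<mu> where "real_distribution \<mu>" "\<And>x. isCont (cdf \<mu>) x"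
    "\<And>x. discounted_length \<beta> R (cdf \<mu> x) = discounted_length \<beta> R 1 * cdf \<nu> x"
proof -
  interpret \<nu>: real_distribution \<nu> by fact
  let ?W = "discounted_length \<beta> R"
  let ?V = "inv_into {0..1} ?W"
  define F where "F x = ?V (?W 1 * cdf \<nu> x)" for x
  note W1 = discounted_length_1_pos[OF R \<beta>]
  note inj = discounted_length_inj[OF R \<beta>]
  note cont = discounted_length_continuous[OF R \<beta>]
  have img: "?W ` {0..1} = {0..?W 1}"
  proof
    show "?W ` {0..1} \<subseteq> {0..?W 1}"
      using discounted_length_strict_mono[OF R \<beta>, of 0] discounted_length_strict_mono[OF R \<beta>, of _ 1]
      by (fastforce simp: le_less)
    show "{0..?W 1} \<subseteq> ?W ` {0..1}"
      using IVT'[of ?W 0 _ 1] cont by fastforce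
  qed
  have in_img: "?W 1 * cdf \<nu> x \<in> ?W ` {0..1}" for x
    unfolding img using W1 cdf_in_unit[OF \<nu>, of x] by (simp add: mult_left_le)
  have WF: "?W (F x) = ?W 1 * cdf \<nu> x" for x
    unfolding F_def by (rule f_inv_into_f[OF in_img])
  have F01: "F x \<in> {0..1}" for x
    unfolding F_def by (rule inv_into_into[OF in_img])
  have Vcont: "continuous_on {0..?W 1} ?V"
    unfolding img[symmetric] using cont
    by (rule continuous_on_inv) (auto simp: inv_into_f_f[OF inj])
  have V0: "?V 0 = 0" and V1: "?V (?W 1) = 1"
    using inv_into_f_f[OF inj, of 0] inv_into_f_f[OF inj, of 1] by auto
  have lim: "(F \<longlongrightarrow> ?V (?W 1 * l)) \<F>" if "(cdf \<nu> \<longlongrightarrow> l) \<F>" "l \<in> {0..1}" for l \<F>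
    unfolding F_def
  proof (rule continuous_on_tendsto_compose[OF Vcont])
    show "((\<lambda>x. ?W 1 * cdf \<nu> x) \<longlongrightarrow> ?W 1 * l) \<F>" by (intro tendsto_intros that)
    show "?W 1 * l \<in> {0..?W 1}" using that W1 by (simp add: mult_left_le)
    show "\<forall>\<^sub>F x in \<F>. ?W 1 * cdf \<nu> x \<in> {0..?W 1}" using in_img unfolding img by simp
  qed
  have Fcont: "isCont F x" for x
    using lim[of "cdf \<nu> x" "at x"] no_atoms[of x] cdf_in_unit[OF \<nu>] unfolding isCont_def F_def by blast
  have Fmono: "F x \<le> F y" if "x \<le> y" for x y
  proof (rule ccontr)
    assume "\<not> F x \<le> F y"
    then have "?W (F y) < ?W (F x)"
      using F01[of x] F01[of y] by (intro discounted_length_strict_mono[OF R \<beta>]) auto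
    then show False
      unfolding WF using W1 \<nu>.cdf_nondecreasing[OF that] by simp
  qed
  have Fbot: "(F \<longlongrightarrow> 0) at_bot" using lim[OF \<nu>.cdf_lim_at_bot] V0 by simp
  have Ftop: "(F \<longlongrightarrow> 1) at_top" using lim[OF \<nu>.cdf_lim_at_top_prob] V1 by simp
  have Fright: "continuous (at_right x) F" for x
    using Fcont by (rule continuous_at_imp_continuous_at_within)
  have cdf_F: "cdf (interval_measure F) = F"
    by (rule cdf_interval_measure) (fact Fmono Fright Fbot Ftop)+
  show ?thesis
  proof (rule that[of "interval_measure F"])
    show "real_distribution (interval_measure F)"
      by (rule real_distribution_interval_measure) (fact Fmono Fright Fbot Ftop)+
  qed (simp_all add: cdf_F Fcont WF)
qed

section \<open>Equilibria of the rank-based game\<close>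

text \<open>
  Brownian motion enters the game through the law \<open>\<nu>\<close> of the terminal value. Continuity of \<open>cdf \<nu>\<close> makes
  equilibria atomless; strict monotonicity lets quantiles be compared through \<open>cdf \<nu>\<close>.
\<close>
locale rank_game = prob_space P for P :: "(real \<Rightarrow> real) measure" +
  fixes T c \<sigma> :: real and \<nu> :: "real measure"
  assumes cost_pos: "0 < c" "0 < \<sigma>"
    and terminal_measurable[measurable]: "(\<lambda>\<omega>. \<omega> T) \<in> borel_measurable P"
    and \<nu>_def: "\<nu> = terminal_law T P"
    and cdf_cont: "\<And>x. isCont (cdf \<nu>) x"
    and cdf_strict: "strict_mono (cdf \<nu>)"
begin

abbreviation "\<beta> \<equiv> 2 * c * \<sigma>\<^sup>2"

lemma \<beta>_pos: "0 < \<beta>"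
  using cost_pos by simp

lemma real_distribution_\<nu>: "real_distribution \<nu>"
  by (simp add: \<nu>_def terminal_law_def)

text \<open>
  The payoff is \<open>\<beta>\<close> times the functional of \<open>gibbs_inequality\<close> when the entropy is finite, and \<open>-\<infinity>\<close>
  otherwise.
\<close>
lemma payoff_gibbs:
  assumes R: "R \<in> rank_rewards" and \<mu>: "real_distribution \<mu>" and Q: "Q \<in> equivalent_probs P"
  defines "g \<equiv> \<lambda>\<omega>. R (cdf \<mu> (\<omega> T)) / \<beta>"
  shows "payoff T c \<sigma> P R \<mu> Q \<le> ereal (\<beta> * ln (\<integral>\<omega>. exp (g \<omega>) \<partial>P))"
    and "payoff T c \<sigma> P R \<mu> Q = ereal (\<beta> * ln (\<integral>\<omega>. exp (g \<omega>) \<partial>P)) \<longleftrightarrow> Q = gibbs_measure P g"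
proof -
  note [measurable] = reward_of_rank(1)[OF R \<mu>]
  have mg: "g \<in> borel_measurable P" unfolding g_def by measurable
  obtain C where C: "\<And>x. \<bar>R (cdf \<mu> x)\<bar> \<le> C" using reward_of_rank(2)[OF R \<mu>] by blast
  have bg: "\<bar>g \<omega>\<bar> \<le> C / \<beta>" for \<omega>
    using C[of "\<omega> T"] cost_pos by (simp add: g_def divide_right_mono abs_mult)
  have Rg: "(\<integral>\<omega>. R (cdf \<mu> (\<omega> T)) \<partial>Q) = \<beta> * (\<integral>\<omega>. g \<omega> \<partial>Q)"
    using cost_pos by (simp add: g_def)
  have "payoff T c \<sigma> P R \<mu> Q \<le> ereal (\<beta> * ln (\<integral>\<omega>. exp (g \<omega>) \<partial>P)) \<and>
    (payoff T c \<sigma> P R \<mu> Q = ereal (\<beta> * ln (\<integral>\<omega>. exp (g \<omega>) \<partial>P)) \<longleftrightarrow> Q = gibbs_measure P g)"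
  proof (cases "integrable Q (entropy_density (exp 1) P Q)")
    case True
    have p: "payoff T c \<sigma> P R \<mu> Q = ereal (\<beta> * ((\<integral>\<omega>. g \<omega> \<partial>Q) - KL_divergence (exp 1) P Q))"
      using True unfolding payoff_def relative_entropy_def Rg by (simp add: algebra_simps)
    show ?thesis
      unfolding p using gibbs_inequality[OF mg bg Q True] cost_pos by simp
  next
    case False
    have p: "payoff T c \<sigma> P R \<mu> Q = -\<infinity>"
      using False cost_pos unfolding payoff_def relative_entropy_def by simp
    show ?thesis
      using False gibbs_measure_finite_entropy[OF mg bg] unfolding p by auto
  qed
  then show "payoff T c \<sigma> P R \<mu> Q \<le> ereal (\<beta> * ln (\<integral>\<omega>. exp (g \<omega>) \<partial>P))"
    and "payoff T c \<sigma> P R \<mu> Q = ereal (\<beta> * ln (\<integral>\<omega>. exp (g \<omega>) \<partial>P)) \<longleftrightarrow> Q = gibbs_measure P g"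
    by auto
qed

lemma gibbs_measure_rank_equivalent:
  assumes R: "R \<in> rank_rewards" and \<mu>: "real_distribution \<mu>"
  shows "gibbs_measure P (\<lambda>\<omega>. R (cdf \<mu> (\<omega> T)) / \<beta>) \<in> equivalent_probs P"
proof -
  note [measurable] = reward_of_rank(1)[OF R \<mu>]
  obtain C where C: "\<And>x. \<bar>R (cdf \<mu> x)\<bar> \<le> C" using reward_of_rank(2)[OF R \<mu>] by blast
  show ?thesis
    using C cost_pos
    by (intro gibbs_measure_equivalent[where C="C / \<beta>"]) (auto simp: divide_right_mono abs_mult)
qed

lemma best_value_eq:
  assumes R: "R \<in> rank_rewards" and \<mu>: "real_distribution \<mu>"
  shows "best_value T c \<sigma> P R \<mu> = ereal (\<beta> * ln (\<integral>x. exp (R (cdf \<mu> x) / \<beta>) \<partial>\<nu>))"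
proof -
  note [measurable] = reward_of_rank(1)[OF R \<mu>]
  have "best_value T c \<sigma> P R \<mu> = ereal (\<beta> * ln (\<integral>\<omega>. exp (R (cdf \<mu> (\<omega> T)) / \<beta>) \<partial>P))"
    unfolding best_value_def
  proof (rule antisym)
    show "(SUP Q\<in>equivalent_probs P. payoff T c \<sigma> P R \<mu> Q) \<le> ereal (\<beta> * ln (\<integral>\<omega>. exp (R (cdf \<mu> (\<omega> T)) / \<beta>) \<partial>P))"
      using payoff_gibbs(1)[OF R \<mu>] by (rule SUP_least)
    show "ereal (\<beta> * ln (\<integral>\<omega>. exp (R (cdf \<mu> (\<omega> T)) / \<beta>) \<partial>P)) \<le> (SUP Q\<in>equivalent_probs P. payoff T c \<sigma> P R \<mu> Q)"
      using payoff_gibbs(2)[OF R \<mu> gibbs_measure_rank_equivalent[OF R \<mu>]]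
      by (intro SUP_upper2[OF gibbs_measure_rank_equivalent[OF R \<mu>]]) simp
  qed
  also have "(\<integral>\<omega>. exp (R (cdf \<mu> (\<omega> T)) / \<beta>) \<partial>P) = (\<integral>x. exp (R (cdf \<mu> x) / \<beta>) \<partial>\<nu>)"
    unfolding \<nu>_def terminal_law_def by (rule integral_distr[symmetric]) auto
  finally show ?thesis .
qed

text \<open>
  The potential is a function of \<open>X\<^sub>T\<close>, so tilting commutes with passing to the terminal law.
\<close>
lemma is_equilibrium_iff_gibbs:
  assumes R: "R \<in> rank_rewards"
  shows "is_equilibrium T c \<sigma> P R \<mu> \<longleftrightarrow>
    real_distribution \<mu> \<and> \<mu> = gibbs_measure \<nu> (\<lambda>x. R (cdf \<mu> x) / \<beta>)"
proof (cases "real_distribution \<mu>")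
  case \<mu>: True
  note [measurable] = reward_of_rank(1)[OF R \<mu>]
  let ?Q = "gibbs_measure P (\<lambda>\<omega>. R (cdf \<mu> (\<omega> T)) / \<beta>)"
  have "best_value T c \<sigma> P R \<mu> = ereal (\<beta> * ln (\<integral>\<omega>. exp (R (cdf \<mu> (\<omega> T)) / \<beta>) \<partial>P))"
    unfolding best_value_eq[OF R \<mu>] \<nu>_def terminal_law_def by (subst integral_distr) auto
  then have "is_equilibrium T c \<sigma> P R \<mu> \<longleftrightarrow> \<mu> = terminal_law T ?Q"
    unfolding is_equilibrium_def
    using payoff_gibbs(2)[OF R \<mu>] gibbs_measure_rank_equivalent[OF R \<mu>] by auto
  also have "terminal_law T ?Q = gibbs_measure \<nu> (\<lambda>x. R (cdf \<mu> x) / \<beta>)"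
    unfolding terminal_law_def \<nu>_def by (rule distr_gibbs_measure) auto
  finally show ?thesis using \<mu> by simp
next
  case False
  have "real_distribution (terminal_law T Q)" if "Q \<in> equivalent_probs P" for Q
  proof -
    interpret Q: prob_space Q using that by (simp add: equivalent_probs_def)
    have "(\<lambda>\<omega>. \<omega> T) \<in> borel_measurable Q"
      using that terminal_measurable by (simp add: equivalent_probs_def cong: measurable_cong_sets)
    then show ?thesis by (simp add: terminal_law_def)
  qed
  then show ?thesis using False by (auto simp: is_equilibrium_def)
qed

text \<open>
  Tilting back turns the fixed point equation into the statement that the law with distribution function
  \<open>W (F\<^sub>\<mu> x) / W 1\<close> is \<open>\<nu>\<close>. An equilibrium has no atoms because it has a density with respect to \<open>\<nu>\<close>; in the
  converse direction the absence of atoms is what makes the rank uniform.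
\<close>
lemma equilibrium_iff:
  assumes R: "R \<in> rank_rewards"
  shows "is_equilibrium T c \<sigma> P R \<mu> \<longleftrightarrow> real_distribution \<mu> \<and> (\<forall>x. isCont (cdf \<mu>) x) \<and>
    (\<forall>x. discounted_length \<beta> R (cdf \<mu> x) = discounted_length \<beta> R 1 * cdf \<nu> x)" (is "?L \<longleftrightarrow> ?R")
    and "is_equilibrium T c \<sigma> P R \<mu> \<Longrightarrow>
      (\<integral>x. exp (R (cdf \<mu> x) / \<beta>) \<partial>\<nu>) = 1 / discounted_length \<beta> R 1"
proof -
  interpret \<nu>: real_distribution \<nu> by (rule real_distribution_\<nu>)
  let ?W = "discounted_length \<beta> R"
  note W1 = discounted_length_1_pos[OF R \<beta>_pos]
  have fwd: "?R \<and> (\<integral>x. exp (R (cdf \<mu> x) / \<beta>) \<partial>\<nu>) = 1 / ?W 1" if ?L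
  proof -
    have \<mu>: "real_distribution \<mu>" and gibbs: "\<mu> = gibbs_measure \<nu> (\<lambda>x. R (cdf \<mu> x) / \<beta>)"
      using that is_equilibrium_iff_gibbs[OF R] by auto
    interpret \<mu>: real_distribution \<mu> by fact
    note [measurable] = reward_of_rank(1)[OF R \<mu>]
    obtain C where C: "\<And>x. \<bar>R (cdf \<mu> x)\<bar> \<le> C" using reward_of_rank(2)[OF R \<mu>] by blast
    have bd: "\<bar>R (cdf \<mu> x) / \<beta>\<bar> \<le> C / \<beta>" for x
      using divide_right_mono[OF C[of x], of \<beta>] cost_pos by (simp add: abs_mult)
    have cont: "isCont (cdf \<mu>) x" for x
    proof -
      have "measure \<nu> {x} = 0" using cdf_cont[of x] \<nu>.isCont_cdf by simp
      then have "{x} \<in> null_sets \<nu>" by (simp add: \<nu>.emeasure_eq_measure null_sets_def)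
      then have "{x} \<in> null_sets (gibbs_measure \<nu> (\<lambda>x. R (cdf \<mu> x) / \<beta>))"
        unfolding gibbs_measure_def
        using absolutely_continuousI_density[of "\<lambda>x. ennreal (exp (R (cdf \<mu> x) / \<beta>) / (\<integral>y. exp (R (cdf \<mu> y) / \<beta>) \<partial>\<nu>))" \<nu>]
        by (auto simp: absolutely_continuous_def)
      then have "{x} \<in> null_sets \<mu>" using gibbs by simp
      then show ?thesis by (simp add: \<mu>.isCont_cdf measure_def null_sets_def)
    qed
    have inv: "gibbs_measure \<mu> (\<lambda>x. - (R (cdf \<mu> x) / \<beta>)) = \<nu>"
      "(\<integral>x. exp (- (R (cdf \<mu> x) / \<beta>)) \<partial>\<mu>) = 1 / (\<integral>x. exp (R (cdf \<mu> x) / \<beta>) \<partial>\<nu>)"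
      using \<nu>.gibbs_measure_inverse[of "\<lambda>x. R (cdf \<mu> x) / \<beta>" "C / \<beta>"] bd unfolding gibbs[symmetric] by auto
    have "?W (cdf \<mu> x) = ?W 1 * cdf \<nu> x" for x
      using cdf_inverse_gibbs[OF \<mu> cont R \<beta>_pos, of x] W1 unfolding inv by simp
    moreover have "(\<lambda>r. exp (- R r / \<beta>)) \<in> borel_measurable (restrict_space borel {0..1})"
      using exp_reward_bounds[OF R \<beta>_pos] by metis
    from rank_integral_eq(2)[OF \<mu> cont this] inv(2)
    have "?W 1 = 1 / (\<integral>x. exp (R (cdf \<mu> x) / \<beta>) \<partial>\<nu>)"
      by (simp add: discounted_length_def)
    ultimately show ?thesis using \<mu> cont by simp
  qed
  show "is_equilibrium T c \<sigma> P R \<mu> \<Longrightarrow> (\<integral>x. exp (R (cdf \<mu> x) / \<beta>) \<partial>\<nu>) = 1 / ?W 1"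
    using fwd by simp
  have bwd: ?L if ?R
  proof -
    have \<mu>: "real_distribution \<mu>" and cont: "\<And>x. isCont (cdf \<mu>) x"
      and eq: "\<And>x. ?W (cdf \<mu> x) = ?W 1 * cdf \<nu> x"
      using that by auto
    interpret \<mu>: real_distribution \<mu> by fact
    note [measurable] = reward_of_rank(1)[OF R \<mu>]
    obtain C where C: "\<And>x. \<bar>R (cdf \<mu> x)\<bar> \<le> C" using reward_of_rank(2)[OF R \<mu>] by blast
    have bd: "\<bar>- (R (cdf \<mu> x) / \<beta>)\<bar> \<le> C / \<beta>" for x
      using divide_right_mono[OF C[of x], of \<beta>] cost_pos by (simp add: abs_mult)
    let ?Q = "gibbs_measure \<mu> (\<lambda>x. - (R (cdf \<mu> x) / \<beta>))"
    have "?Q \<in> equivalent_probs \<mu>"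
      by (rule \<mu>.gibbs_measure_equivalent[where C="C / \<beta>"]) (use bd in auto)
    then have "real_distribution ?Q"
      by (auto simp: equivalent_probs_def real_distribution_def real_distribution_axioms_def)
    moreover have "cdf ?Q = cdf \<nu>"
      using cdf_inverse_gibbs[OF \<mu> cont R \<beta>_pos] eq W1 by (simp add: fun_eq_iff)
    ultimately have "?Q = \<nu>" using real_distribution_\<nu> by (intro cdf_unique)
    with \<mu>.gibbs_measure_inverse(1)[of "\<lambda>x. - (R (cdf \<mu> x) / \<beta>)" "C / \<beta>"] bd
    have "gibbs_measure \<nu> (\<lambda>x. R (cdf \<mu> x) / \<beta>) = \<mu>" by simp
    then show ?L using is_equilibrium_iff_gibbs[OF R] \<mu> by simp
  qed
  show "?L \<longleftrightarrow> ?R" using fwd bwd by blast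
qed

lemma equilibrium_unique:
  assumes R: "R \<in> rank_rewards"
  shows "\<exists>!\<mu>. is_equilibrium T c \<sigma> P R \<mu>"
proof -
  obtain \<mu> where \<mu>: "is_equilibrium T c \<sigma> P R \<mu>"
    using rank_cdf_exists[OF R \<beta>_pos real_distribution_\<nu> cdf_cont] equilibrium_iff(1)[OF R] by metis
  have "\<mu>' = \<mu>" if "is_equilibrium T c \<sigma> P R \<mu>'" for \<mu>'
  proof (rule cdf_unique)
    show rd: "real_distribution \<mu>'" "real_distribution \<mu>"
      using \<mu> that equilibrium_iff(1)[OF R] by auto
    have "discounted_length \<beta> R (cdf \<mu>' x) = discounted_length \<beta> R (cdf \<mu> x)" for x
      using \<mu> that equilibrium_iff(1)[OF R] by simp
    then show "cdf \<mu>' = cdf \<mu>"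
      using discounted_length_inj[OF R \<beta>_pos] cdf_in_unit rd by (auto simp: fun_eq_iff inj_on_def)
  qed
  with \<mu> show ?thesis by blast
qed

lemma is_equilibrium_equilibrium:
  assumes R: "R \<in> rank_rewards"
  shows "is_equilibrium T c \<sigma> P R (equilibrium T c \<sigma> P R)"
  unfolding equilibrium_def by (rule theI'[OF equilibrium_unique[OF R]])

lemma game_value_eq:
  assumes R: "R \<in> rank_rewards"
  shows "game_value T c \<sigma> P R = ereal (- \<beta> * ln (discounted_length \<beta> R 1))"
proof -
  note eq = is_equilibrium_equilibrium[OF R]
  then have "real_distribution (equilibrium T c \<sigma> P R)" using equilibrium_iff(1)[OF R] by simp
  then show ?thesis
    using discounted_length_1_pos[OF R \<beta>_pos]
    by (simp add: game_value_def best_value_eq[OF R] equilibrium_iff(2)[OF R eq] ln_div)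
qed

lemma equilibrium_quantile:
  assumes R: "R \<in> rank_rewards" and p: "0 < p" "p < 1"
  shows "cdf \<nu> (quantile (equilibrium T c \<sigma> P R) p) = discounted_length \<beta> R p / discounted_length \<beta> R 1"
proof -
  let ?\<mu> = "equilibrium T c \<sigma> P R"
  have "real_distribution ?\<mu>" "\<And>x. isCont (cdf ?\<mu>) x"
    and eq: "\<And>x. discounted_length \<beta> R (cdf ?\<mu> x) = discounted_length \<beta> R 1 * cdf \<nu> x"
    using is_equilibrium_equilibrium[OF R] equilibrium_iff(1)[OF R] by auto
  then have "cdf ?\<mu> (quantile ?\<mu> p) = p" by (intro cdf_quantile p)
  then show ?thesis using eq[of "quantile ?\<mu> p"] discounted_length_1_pos[OF R \<beta>_pos] by simp
qed

lemma equilibrium_gibbs: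
  assumes R: "R \<in> rank_rewards"
  defines "\<mu> \<equiv> equilibrium T c \<sigma> P R"
  shows "\<mu> = density \<nu> (\<lambda>x. ennreal (exp (R (cdf \<mu> x) / \<beta>) * discounted_length \<beta> R 1))"
proof -
  have eq: "is_equilibrium T c \<sigma> P R \<mu>"
    using is_equilibrium_equilibrium[OF R] by (simp add: \<mu>_def)
  then have "\<mu> = gibbs_measure \<nu> (\<lambda>x. R (cdf \<mu> x) / \<beta>)"
    using is_equilibrium_iff_gibbs[OF R] by blast
  then show ?thesis
    unfolding gibbs_measure_def equilibrium_iff(2)[OF R eq] by simp
qed

end

section \<open>Maximising the quantile\<close>

text \<open>
  The tangent of \<open>exp\<close> at \<open>m\<close>, divided by \<open>exp m\<close>, lies below: \<open>1 - m + h \<le> exp (h - m)\<close>. With \<open>m\<close> the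
  logarithm of the mean of \<open>exp h\<close>, the right-hand side integrates to the measure of \<open>S\<close>. The tangent
  touches at \<open>m\<close> only, which settles the case of equality.
\<close>
lemma jensen_exp:
  fixes h :: "'b \<Rightarrow> real"
  assumes S: "S \<in> sets M" "emeasure M S < \<infinity>" "0 < measure M S"
    and h: "set_integrable M S h" and eh: "set_integrable M S (\<lambda>x. exp (h x))"
    and pos: "0 < (LINT x:S|M. exp (h x))"
  defines "m \<equiv> ln ((LINT x:S|M. exp (h x)) / measure M S)"
  shows "(LINT x:S|M. h x) \<le> measure M S * m"
    and "(LINT x:S|M. h x) = measure M S * m \<Longrightarrow> AE x in M. x \<in> S \<longrightarrow> h x = m"
proof -
  define gap where "gap x = exp (- m) * exp (h x) - (1 - m + h x)" for x
  have gap_exp: "gap x = exp (h x - m) - (1 + (h x - m))" for x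
    by (simp add: gap_def exp_diff exp_minus field_simps)
  have gap_nn: "0 \<le> gap x" for x
    unfolding gap_exp using exp_ge_add_one_self[of "h x - m"] by simp
  have gap_0: "h x = m" if "gap x = 0" for x
  proof -
    have "ln (exp (h x - m)) = exp (h x - m) - 1" using that unfolding gap_exp ln_exp by linarith
    then have "exp (h x - m) = 1" by (intro ln_eq_minus_one) auto
    then show ?thesis by simp
  qed
  have const: "set_integrable M S (\<lambda>_. k)" "(LINT x:S|M. k) = k * measure M S" for k :: real
    using S by (auto simp: set_integrable_def set_lebesgue_integral_def less_top)
  have ei: "set_integrable M S (\<lambda>x. exp (- m) * exp (h x))"
    using eh by (intro set_integrable_mult_right) simp
  have li: "set_integrable M S (\<lambda>x. 1 - m + h x)" by (intro set_integral_add(1) const(1) h)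
  have gi: "set_integrable M S gap"
    unfolding gap_def by (rule set_integral_diff(1)[OF ei li])
  have "(LINT x:S|M. gap x) = (LINT x:S|M. exp (- m) * exp (h x)) - (LINT x:S|M. 1 - m + h x)"
    unfolding gap_def by (rule set_integral_diff(2)[OF ei li])
  also have "(LINT x:S|M. 1 - m + h x) = (1 - m) * measure M S + (LINT x:S|M. h x)"
    by (subst set_integral_add(2)[OF const(1) h]) (simp add: const(2))
  also have "(LINT x:S|M. exp (- m) * exp (h x)) = exp (- m) * (LINT x:S|M. exp (h x))"
    by simp
  also have "exp (- m) * (LINT x:S|M. exp (h x)) = measure M S"
    unfolding m_def using pos S by (simp add: exp_minus)
  finally have gap_int: "(LINT x:S|M. gap x) = measure M S * m - (LINT x:S|M. h x)"
    by (simp add: algebra_simps)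
  have "0 \<le> (LINT x:S|M. gap x)"
    unfolding set_lebesgue_integral_def using gap_nn by (intro integral_nonneg_AE) auto
  then show "(LINT x:S|M. h x) \<le> measure M S * m" using gap_int by simp
  assume "(LINT x:S|M. h x) = measure M S * m"
  then have "(\<integral>x. indicator S x *\<^sub>R gap x \<partial>M) = 0"
    using gap_int by (simp add: set_lebesgue_integral_def)
  then have "AE x in M. indicator S x *\<^sub>R gap x = 0"
    using gi gap_nn unfolding set_integrable_def
    by (subst (asm) integral_nonneg_eq_0_iff_AE) auto
  then show "AE x in M. x \<in> S \<longrightarrow> h x = m"
    by eventually_elim (auto dest: gap_0)
qed

text \<open>
  The relative entropy of the two-point law \<open>(\<alpha>, 1 - \<alpha>)\<close> with respect to \<open>(x, 1 - x)\<close>.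
\<close>
definition binary_divergence :: "real \<Rightarrow> real \<Rightarrow> real" where
  "binary_divergence \<alpha> x = \<alpha> * ln (\<alpha> / x) + (1 - \<alpha>) * ln ((1 - \<alpha>) / (1 - x))"

lemma binary_divergence_continuous:
  assumes "0 < \<alpha>" "\<alpha> < 1" "\<alpha> \<le> a" "b < 1"
  shows "continuous_on {a..b} (binary_divergence \<alpha>)"
  unfolding binary_divergence_def using assms
  by (intro continuous_intros) (auto simp: divide_eq_0_iff)

text \<open>
  The derivative is \<open>(x - \<alpha>) / (x (1 - x))\<close>.
\<close>
lemma binary_divergence_strict_mono:
  assumes \<alpha>: "0 < \<alpha>" "\<alpha> < 1" and xy: "\<alpha> \<le> x" "x < y" "y < 1"
  shows "binary_divergence \<alpha> x < binary_divergence \<alpha> y"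
proof (rule DERIV_pos_imp_increasing_open[OF xy(2)])
  fix z assume z: "x < z" "z < y"
  have "(binary_divergence \<alpha> has_real_derivative (z - \<alpha>) / (z * (1 - z))) (at z)"
    unfolding binary_divergence_def using \<alpha> xy z
    by (auto intro!: derivative_eq_intros simp: divide_simps) (simp_all add: algebra_simps power2_eq_square)
  moreover have "0 < (z - \<alpha>) / (z * (1 - z))" using \<alpha> xy z by simp
  ultimately show "\<exists>d. (binary_divergence \<alpha> has_real_derivative d) (at z) \<and> 0 < d" by blast
qed (use assms in \<open>auto intro: binary_divergence_continuous\<close>)

lemma binary_divergence_inverse:
  assumes \<alpha>: "0 < \<alpha>" "\<alpha> < 1" and k: "0 \<le> k"
  shows "\<exists>!x. \<alpha> \<le> x \<and> x < 1 \<and> binary_divergence \<alpha> x = k"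
proof -
  \<comment> \<open>The point \<open>y\<close> solves \<open>(1 - \<alpha>) ln ((1 - \<alpha>) / (1 - y)) = k - \<alpha> ln \<alpha>\<close>; the remaining term of the divergence is at least \<open>\<alpha> ln \<alpha>\<close>, so the level \<open>k\<close> is reached before \<open>y\<close>.\<close>
  define e where "e = (k - \<alpha> * ln \<alpha>) / (1 - \<alpha>)"
  define y where "y = 1 - (1 - \<alpha>) * exp (- e)"
  have "\<alpha> * ln \<alpha> \<le> 0" using \<alpha> by (intro mult_nonneg_nonpos) auto
  then have "0 \<le> e" using \<alpha> k by (simp add: e_def)
  then have "(1 - \<alpha>) * exp (- e) \<le> 1 - \<alpha>" "0 < (1 - \<alpha>) * exp (- e)"
    using \<alpha> by (auto intro!: mult_left_le)
  then have y: "\<alpha> \<le> y" "y < 1" unfolding y_def by linarith+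
  have "(1 - \<alpha>) / (1 - y) = exp e" using \<alpha> by (simp add: y_def exp_minus field_simps)
  then have "(1 - \<alpha>) * ln ((1 - \<alpha>) / (1 - y)) = k - \<alpha> * ln \<alpha>"
    using \<alpha> by (simp add: e_def)
  moreover have "\<alpha> * ln \<alpha> \<le> \<alpha> * ln (\<alpha> / y)"
    using \<alpha> y by (intro mult_left_mono) (auto simp: ln_div)
  ultimately have "k \<le> binary_divergence \<alpha> y" by (simp add: binary_divergence_def)
  moreover have "binary_divergence \<alpha> \<alpha> = 0" using \<alpha> by (simp add: binary_divergence_def)
  ultimately obtain x where x: "\<alpha> \<le> x" "x \<le> y" "binary_divergence \<alpha> x = k"
    using IVT'[of "binary_divergence \<alpha>" \<alpha> k y] k y binary_divergence_continuous[OF \<alpha> order_refl y(2)] by auto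
  have uniq: "x' = x" if "\<alpha> \<le> x'" "x' < 1" "binary_divergence \<alpha> x' = k" for x'
    using that x y binary_divergence_strict_mono[OF \<alpha>, of x x'] binary_divergence_strict_mono[OF \<alpha>, of x' x]
    by (cases x x' rule: linorder_cases) auto
  have "x < 1" using x(2) y(2) by linarith
  with x(1,3) uniq show ?thesis by (intro ex1I[of _ x]) blast+
qed

lemma solves_level_equation_iff:
  "solves_level_equation c \<sigma> V0 K \<alpha> x \<longleftrightarrow>
    \<alpha> \<le> x \<and> x < 1 \<and> binary_divergence \<alpha> x = (K - V0) / (2 * c * \<sigma>\<^sup>2)"
  by (simp add: solves_level_equation_def binary_divergence_def)

lemma set_integral_step:
  fixes a b :: real
  assumes "0 \<le> \<alpha>" "\<alpha> \<le> u"
  shows "(LINT r:{0..u}|lborel. if r < \<alpha> then a else b) = \<alpha> * a + (u - \<alpha>) * b"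
proof -
  have "(LINT r:{0..u}|lborel. if r < \<alpha> then a else b)
      = (\<integral>r. indicator {0..<\<alpha>} r *\<^sub>R a + indicator {\<alpha>..u} r *\<^sub>R b \<partial>lborel)"
    unfolding set_lebesgue_integral_def
    by (rule Bochner_Integration.integral_cong) (use assms in \<open>auto simp: indicator_def\<close>)
  also have "\<dots> = \<alpha> * a + (u - \<alpha>) * b"
    using assms by (subst Bochner_Integration.integral_add) auto
  finally show ?thesis .
qed

context rank_game
begin

lemma feasible_rewards_iff:
  "R \<in> feasible_rewards T c \<sigma> P V0 K \<longleftrightarrow> R \<in> rank_rewards \<and> (LINT r:{0..1}|lborel. R r) \<le> K \<and>
    ln (discounted_length \<beta> R 1) \<le> - (V0 / \<beta>)"
proof -
  have "V0 \<le> - \<beta> * l \<longleftrightarrow> l \<le> - (V0 / \<beta>)" for l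
    using \<beta>_pos by (auto simp: field_simps)
  then have "ereal V0 \<le> game_value T c \<sigma> P R \<longleftrightarrow> ln (discounted_length \<beta> R 1) \<le> - (V0 / \<beta>)"
    if "R \<in> rank_rewards"
    unfolding game_value_eq[OF that] ereal_less_eq(3) .
  then show ?thesis unfolding feasible_rewards_def by blast
qed

text \<open>
  With \<open>s = W 1\<close>, Jensen's inequality on the two pieces gives
  \<open>- K / \<beta> \<le> - \<integral> R / \<beta> \<le> ln s - binary_divergence \<alpha> x\<close>, and participation gives \<open>ln s \<le> - V0 / \<beta>\<close>.
  Together these place the divergence at \<open>x\<close> below the level at \<open>x\<alpha>\<close>. If \<open>x = x\<alpha>\<close>, the whole chain is
  tight: \<open>R\<close> is constant on both pieces and \<open>ln s = - V0 / \<beta>\<close>.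
\<close>
lemma feasible_level_bound:
  assumes \<alpha>: "0 < \<alpha>" "\<alpha> < 1" and R: "R \<in> feasible_rewards T c \<sigma> P V0 K"
    and x\<alpha>: "solves_level_equation c \<sigma> V0 K \<alpha> x\<alpha>"
  defines "x \<equiv> discounted_length \<beta> R \<alpha> / discounted_length \<beta> R 1"
  shows "x \<le> x\<alpha>"
    and "x = x\<alpha> \<Longrightarrow> AE r in lborel. r \<in> {0..1} \<longrightarrow> R r = step_reward c \<sigma> V0 \<alpha> x\<alpha> r"
proof -
  have rr: "R \<in> rank_rewards" and budget: "(LINT r:{0..1}|lborel. R r) \<le> K"
    and participation: "ln (discounted_length \<beta> R 1) \<le> - (V0 / \<beta>)"
    using R by (auto simp: feasible_rewards_iff)
  have level: "\<alpha> \<le> x\<alpha>" "x\<alpha> < 1" "binary_divergence \<alpha> x\<alpha> = (K - V0) / \<beta>"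
    using x\<alpha> by (auto simp: solves_level_equation_iff)
  define s A where "s = discounted_length \<beta> R 1" and "A = discounted_length \<beta> R \<alpha>"
  have s: "0 < s" unfolding s_def by (rule discounted_length_1_pos[OF rr \<beta>_pos])
  have A: "0 < A" "A < s"
    using discounted_length_strict_mono[OF rr \<beta>_pos, of 0 \<alpha>] discounted_length_strict_mono[OF rr \<beta>_pos, of \<alpha> 1] \<alpha>
    by (auto simp: A_def s_def)
  have x_eq: "x = A / s" by (simp only: x_def A_def s_def)
  have A_eq: "A = s * x" and B_eq: "s - A = s * (1 - x)" and x01: "0 < x" "x < 1"
    using s A unfolding x_eq by (auto simp: field_simps)
  obtain C where C: "\<And>r. r \<in> {0..1} \<Longrightarrow> \<bar>R r\<bar> \<le> C" and Rm[measurable]: "R \<in> borel_measurable (restrict_space borel {0..1})"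
    using rank_rewardsE[OF rr] by blast
  have Ri: "set_integrable lborel S R" if "S \<in> sets borel" "S \<subseteq> {0..1}" for S
    by (rule set_integrable_bounded[OF Rm C that])
  let ?h = "\<lambda>r. - R r / \<beta>"
  have hi: "set_integrable lborel S ?h" if "S \<in> sets borel" "S \<subseteq> {0..1}" for S
    using set_integrable_mult_right[of "- 1 / \<beta>" lborel S R] Ri[OF that] by simp
  have int_h: "(LINT r:S|lborel. ?h r) = - (LINT r:S|lborel. R r) / \<beta>" for S
    using set_integral_mult_right[of lborel S "- 1 / \<beta>" R] by simp
  have A_int: "(LINT r:{0..\<alpha>}|lborel. exp (?h r)) = A"
    by (simp add: A_def discounted_length_def)
  have B_int: "(LINT r:{\<alpha><..1}|lborel. exp (?h r)) = s - A"
    using discounted_length_split[OF rr \<beta>_pos, of \<alpha> 1] \<alpha> by (simp add: A_def s_def)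
  define m1 m2 where "m1 = ln (A / \<alpha>)" and "m2 = ln ((s - A) / (1 - \<alpha>))"
  have J1: "(LINT r:{0..\<alpha>}|lborel. ?h r) \<le> \<alpha> * m1"
    and E1: "(LINT r:{0..\<alpha>}|lborel. ?h r) = \<alpha> * m1 \<Longrightarrow> AE r in lborel. r \<in> {0..\<alpha>} \<longrightarrow> ?h r = m1"
    using jensen_exp[of "{0..\<alpha>}" lborel ?h, OF _ _ _ hi exp_reward_integrable[OF rr \<beta>_pos], unfolded A_int] \<alpha> A
    by (auto simp: m1_def)
  have sub: "{\<alpha><..1} \<subseteq> {0..1}" using \<alpha> by auto
  have J2: "(LINT r:{\<alpha><..1}|lborel. ?h r) \<le> (1 - \<alpha>) * m2"
    and E2: "(LINT r:{\<alpha><..1}|lborel. ?h r) = (1 - \<alpha>) * m2 \<Longrightarrow> AE r in lborel. r \<in> {\<alpha><..1} \<longrightarrow> ?h r = m2"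
    using jensen_exp[of "{\<alpha><..1}" lborel ?h, OF _ _ _ hi exp_reward_integrable[OF rr \<beta>_pos], unfolded B_int] sub \<alpha> A
    by (auto simp: m2_def)
  have "{0..1} = {0..\<alpha>} \<union> {\<alpha><..1}" using \<alpha> by auto
  then have split: "(LINT r:{0..1}|lborel. ?h r) = (LINT r:{0..\<alpha>}|lborel. ?h r) + (LINT r:{\<alpha><..1}|lborel. ?h r)"
    by (simp only:) (intro set_integral_Un hi; use \<alpha> in auto)
  have "(LINT r:{0..1}|lborel. ?h r) \<ge> - (K / \<beta>)"
    using budget \<beta>_pos unfolding int_h by (simp add: divide_right_mono)
  moreover have m1_eq: "m1 = ln s - ln (\<alpha> / x)"
    unfolding m1_def A_eq using s \<alpha> x01 by (simp add: ln_div ln_mult)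
  moreover have m2_eq: "m2 = ln s - ln ((1 - \<alpha>) / (1 - x))"
    unfolding m2_def B_eq using s \<alpha> x01 by (simp add: ln_div ln_mult)
  have sum_eq: "\<alpha> * m1 + (1 - \<alpha>) * m2 = ln s - binary_divergence \<alpha> x"
    unfolding m1_eq m2_eq binary_divergence_def by (simp add: algebra_simps)
  ultimately have chain: "- (K / \<beta>) \<le> (LINT r:{0..\<alpha>}|lborel. ?h r) + (LINT r:{\<alpha><..1}|lborel. ?h r)"
    using split by simp
  have part: "ln s \<le> - (V0 / \<beta>)" using participation by (simp add: s_def)
  have target: "binary_divergence \<alpha> x\<alpha> = K / \<beta> - V0 / \<beta>" using level by (simp add: diff_divide_distrib)
  have "binary_divergence \<alpha> x \<le> binary_divergence \<alpha> x\<alpha>"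
    using chain J1 J2 sum_eq part target by linarith
  then show "x \<le> x\<alpha>"
    using binary_divergence_strict_mono[OF \<alpha> level(1) _ x01(2)] by fastforce
  assume eq: "x = x\<alpha>"
  have "(LINT r:{0..\<alpha>}|lborel. ?h r) = \<alpha> * m1" "(LINT r:{\<alpha><..1}|lborel. ?h r) = (1 - \<alpha>) * m2"
    and tight: "ln s = - (V0 / \<beta>)"
    using chain J1 J2 sum_eq part target unfolding eq by linarith+
  from E1[OF this(1)] E2[OF this(2)] AE_lborel_singleton[of \<alpha>]
  show "AE r in lborel. r \<in> {0..1} \<longrightarrow> R r = step_reward c \<sigma> V0 \<alpha> x\<alpha> r"
  proof eventually_elim
    case (elim r)
    show ?case
    proof
      assume r: "r \<in> {0..1}"
      have "- R r / \<beta> = - (V0 / \<beta>) - (if r < \<alpha> then ln (\<alpha> / x\<alpha>) else ln ((1 - \<alpha>) / (1 - x\<alpha>)))"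
        using elim r unfolding m1_eq m2_eq tight eq by auto
      then have "\<beta> * (- R r / \<beta>) = \<beta> * (- (V0 / \<beta>) - (if r < \<alpha> then ln (\<alpha> / x\<alpha>) else ln ((1 - \<alpha>) / (1 - x\<alpha>))))"
        by simp
      then have "R r = V0 + \<beta> * (if r < \<alpha> then ln (\<alpha> / x\<alpha>) else ln ((1 - \<alpha>) / (1 - x\<alpha>)))"
        using cost_pos by (simp add: right_diff_distrib)
      then show "R r = step_reward c \<sigma> V0 \<alpha> x\<alpha> r" by (simp add: step_reward_def)
    qed
  qed
qed

text \<open>
  Since \<open>exp (- Rs / \<beta>)\<close> is \<open>exp (- V0 / \<beta>)\<close> times \<open>x\<alpha> / \<alpha>\<close> on the ranks below \<open>\<alpha>\<close> and times
  \<open>(1 - x\<alpha>) / (1 - \<alpha>)\<close> above, the participation constraint binds; the level equation says that the budget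
  does too. The step goes upwards because \<open>\<alpha> \<le> x\<alpha>\<close>.
\<close>
lemma step_reward_feasible:
  assumes \<alpha>: "0 < \<alpha>" "\<alpha> < 1" and x\<alpha>: "solves_level_equation c \<sigma> V0 K \<alpha> x\<alpha>"
  defines "Rs \<equiv> step_reward c \<sigma> V0 \<alpha> x\<alpha>"
  shows "Rs \<in> feasible_rewards T c \<sigma> P V0 K"
    and "discounted_length \<beta> Rs \<alpha> = exp (- (V0 / \<beta>)) * x\<alpha>"
    and "discounted_length \<beta> Rs 1 = exp (- (V0 / \<beta>))"
proof -
  have level: "\<alpha> \<le> x\<alpha>" "x\<alpha> < 1" "binary_divergence \<alpha> x\<alpha> = (K - V0) / \<beta>"
    using x\<alpha> by (auto simp: solves_level_equation_iff)
  have Rs: "Rs r = (if r < \<alpha> then V0 + \<beta> * ln (\<alpha> / x\<alpha>) else V0 + \<beta> * ln ((1 - \<alpha>) / (1 - x\<alpha>)))" for r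
    by (simp add: Rs_def step_reward_def)
  have ex: "exp (- Rs r / \<beta>) = (if r < \<alpha> then exp (- (V0 / \<beta>)) * (x\<alpha> / \<alpha>) else exp (- (V0 / \<beta>)) * ((1 - x\<alpha>) / (1 - \<alpha>)))" for r
  proof -
    have "- Rs r / \<beta> = - (V0 / \<beta>) - (if r < \<alpha> then ln (\<alpha> / x\<alpha>) else ln ((1 - \<alpha>) / (1 - x\<alpha>)))"
      using cost_pos by (simp add: Rs add_divide_distrib)
    then show ?thesis using \<alpha> level by (simp add: exp_diff)
  qed
  have "\<alpha> / x\<alpha> \<le> (1 - \<alpha>) / (1 - x\<alpha>)"
    using \<alpha> level by (simp add: divide_simps algebra_simps)
  then have mono_ln: "ln (\<alpha> / x\<alpha>) \<le> ln ((1 - \<alpha>) / (1 - x\<alpha>))"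
    using \<alpha> level by (intro ln_mono) auto
  have rr: "Rs \<in> rank_rewards"
  proof -
    have "mono_on {0..1} Rs"
      using mono_ln cost_pos by (auto intro!: mono_onI mult_left_mono simp: Rs)
    moreover have "bounded (Rs ` {0..1})"
      by (rule bounded_subset[of "{V0 + \<beta> * ln (\<alpha> / x\<alpha>), V0 + \<beta> * ln ((1 - \<alpha>) / (1 - x\<alpha>))}"])
        (auto simp: Rs)
    ultimately show ?thesis by (simp add: rank_rewards_def)
  qed
  show A: "discounted_length \<beta> Rs \<alpha> = exp (- (V0 / \<beta>)) * x\<alpha>"
    unfolding discounted_length_def ex using \<alpha> by (subst set_integral_step) auto
  show one: "discounted_length \<beta> Rs 1 = exp (- (V0 / \<beta>))"
    unfolding discounted_length_def ex using \<alpha>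
    by (subst set_integral_step) (auto simp flip: distrib_left)
  have "(LINT r:{0..1}|lborel. Rs r) = V0 + \<beta> * binary_divergence \<alpha> x\<alpha>"
    unfolding Rs using \<alpha> by (subst set_integral_step) (auto simp: binary_divergence_def algebra_simps)
  also have "\<dots> = K" unfolding level using cost_pos by simp
  finally show "Rs \<in> feasible_rewards T c \<sigma> P V0 K"
    using rr one by (simp add: feasible_rewards_iff)
qed

text \<open>
  For a feasible reward, \<open>cdf \<nu>\<close> at the equilibrium quantile is the ratio bounded in
  \<open>feasible_level_bound\<close>, and \<open>cdf \<nu>\<close> is strictly increasing, so bounds and equalities for the ratio
  are the same as for the quantile. The density is the Gibbs density \<open>exp (Rs (F\<^sub>\<mu> x) / \<beta>) * W 1\<close>, which jumps
  where \<open>F\<^sub>\<mu>\<close> reaches \<open>\<alpha>\<close>, that is, at the quantile.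
\<close>
lemma optimal_step_reward:
  assumes \<alpha>: "0 < \<alpha>" "\<alpha> < 1" and x\<alpha>: "solves_level_equation c \<sigma> V0 K \<alpha> x\<alpha>"
  defines "Rs \<equiv> step_reward c \<sigma> V0 \<alpha> x\<alpha>"
  defines "q \<equiv> quantile (equilibrium T c \<sigma> P Rs) \<alpha>"
  shows "cdf \<nu> q = x\<alpha>"
    and "optimal_quantile T c \<sigma> P V0 K \<alpha> = ereal q"
    and "R \<in> feasible_rewards T c \<sigma> P V0 K \<Longrightarrow> quantile (equilibrium T c \<sigma> P R) \<alpha> = q \<Longrightarrow>
      AE r in lborel. r \<in> {0..1} \<longrightarrow> R r = Rs r"
    and "equilibrium T c \<sigma> P Rs =
      density \<nu> (\<lambda>x. ennreal (if x < q then \<alpha> / x\<alpha> else (1 - \<alpha>) / (1 - x\<alpha>)))"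
proof -
  note step = step_reward_feasible[OF \<alpha> x\<alpha>, folded Rs_def]
  have rr: "R \<in> rank_rewards" if "R \<in> feasible_rewards T c \<sigma> P V0 K" for R
    using that by (simp add: feasible_rewards_def)
  have level: "\<alpha> \<le> x\<alpha>" "x\<alpha> < 1"
    using x\<alpha> by (auto simp: solves_level_equation_iff)
  show q: "cdf \<nu> q = x\<alpha>"
    unfolding q_def equilibrium_quantile[OF rr[OF step(1)] \<alpha>] step(2,3) by simp
  have "quantile (equilibrium T c \<sigma> P R) \<alpha> \<le> q" if R: "R \<in> feasible_rewards T c \<sigma> P V0 K" for R
  proof -
    have "cdf \<nu> (quantile (equilibrium T c \<sigma> P R) \<alpha>) \<le> cdf \<nu> q"
      unfolding q equilibrium_quantile[OF rr[OF R] \<alpha>] by (rule feasible_level_bound(1)[OF \<alpha> R x\<alpha>])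
    then show ?thesis using strict_mono_less_eq[OF cdf_strict] by blast
  qed
  then show "optimal_quantile T c \<sigma> P V0 K \<alpha> = ereal q"
    unfolding optimal_quantile_def q_def
    by (intro antisym SUP_least SUP_upper2[OF step(1)]) auto
  show "AE r in lborel. r \<in> {0..1} \<longrightarrow> R r = Rs r"
    if R: "R \<in> feasible_rewards T c \<sigma> P V0 K" "quantile (equilibrium T c \<sigma> P R) \<alpha> = q"
    unfolding Rs_def
  proof (rule feasible_level_bound(2)[OF \<alpha> R(1) x\<alpha>])
    show "discounted_length \<beta> R \<alpha> / discounted_length \<beta> R 1 = x\<alpha>"
      using equilibrium_quantile[OF rr[OF R(1)] \<alpha>] q unfolding R(2) by simp
  qed
  let ?\<mu> = "equilibrium T c \<sigma> P Rs"
  have \<mu>: "real_distribution ?\<mu>"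
    using is_equilibrium_equilibrium[OF rr[OF step(1)]] equilibrium_iff(1)[OF rr[OF step(1)]] by simp
  interpret \<mu>: cdf_distribution ?\<mu> using \<mu> by (simp add: cdf_distribution_def)
  have below: "cdf ?\<mu> x < \<alpha> \<longleftrightarrow> x < q" for x
    using \<mu>.pseudoinverse[OF \<alpha>, of x] unfolding q_def quantile_def by linarith
  have Rs: "Rs r / \<beta> = V0 / \<beta> + (if r < \<alpha> then ln (\<alpha> / x\<alpha>) else ln ((1 - \<alpha>) / (1 - x\<alpha>)))" for r
    using cost_pos by (simp add: Rs_def step_reward_def add_divide_distrib)
  have "exp (Rs (cdf ?\<mu> x) / \<beta>) * exp (- (V0 / \<beta>)) = (if x < q then \<alpha> / x\<alpha> else (1 - \<alpha>) / (1 - x\<alpha>))" for x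
  proof -
    show ?thesis
      unfolding Rs below using \<alpha> level by (simp add: exp_add exp_minus)
  qed
  then show "?\<mu> = density \<nu> (\<lambda>x. ennreal (if x < q then \<alpha> / x\<alpha> else (1 - \<alpha>) / (1 - x\<alpha>)))"
    using equilibrium_gibbs[OF rr[OF step(1)]] unfolding step(3) by simp
qed

end

section \<open>Brownian motion as the reference model\<close>

lemma cdf_normal:
  assumes "0 < s"
  shows "cdf (density lborel (normal_density m s)) x = cdf std_normal_distribution ((x - m) / s)"
proof -
  let ?N = "density lborel (normal_density m s)"
  interpret N: prob_space ?N by (rule prob_space_normal_density[OF assms])
  have "distributed ?N lborel (\<lambda>x. x) (normal_density m s)"
    by (auto simp: distributed_def distr_id2)
  then have "distributed ?N lborel (\<lambda>x. (x - m) / s) std_normal_density"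
    using N.normal_standard_normal_convert[OF assms, of "\<lambda>x. x" m] by simp
  then have std: "distr ?N lborel (\<lambda>x. (x - m) / s) = std_normal_distribution"
    by (simp add: distributed_def)
  have "cdf std_normal_distribution ((x - m) / s) = measure ?N ((\<lambda>x. (x - m) / s) -` {..(x - m) / s} \<inter> space ?N)"
    unfolding std[symmetric] cdf_def by (rule measure_distr) auto
  also have "(\<lambda>x. (x - m) / s) -` {..(x - m) / s} \<inter> space ?N = {..x}"
    using assms by (auto simp: divide_right_mono divide_le_cancel)
  finally show ?thesis by (simp add: cdf_def)
qed

lemma isCont_cdf_normal:
  assumes "0 < s"
  shows "isCont (cdf (density lborel (normal_density m s))) x"
proof -
  let ?N = "density lborel (normal_density m s)"
  interpret real_distribution ?N
    by (simp add: real_distribution_def real_distribution_axioms_def prob_space_normal_density assms)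
  have "{x} \<in> null_sets ?N"
  proof -
    have "AE z in lborel. z \<in> {x} \<longrightarrow> ennreal (normal_density m s z) = 0"
      using AE_lborel_singleton[of x] by eventually_elim simp
    then show ?thesis by (subst null_sets_density_iff) auto
  qed
  then show ?thesis by (simp add: isCont_cdf measure_def null_sets_def)
qed

lemma strict_mono_cdf_normal:
  assumes "0 < s"
  shows "strict_mono (cdf (density lborel (normal_density m s)))"
proof (rule strict_monoI)
  fix x y :: real assume "x < y"
  let ?N = "density lborel (normal_density m s)"
  interpret real_distribution ?N
    by (simp add: real_distribution_def real_distribution_axioms_def prob_space_normal_density assms)
  have "{x<..y} \<notin> null_sets ?N"
  proof
    assume "{x<..y} \<in> null_sets ?N"
    then have "AE z in lborel. z \<in> {x<..y} \<longrightarrow> ennreal (normal_density m s z) = 0"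
      by (subst (asm) null_sets_density_iff) auto
    then have "AE z in lborel. z \<notin> {x<..y}"
    proof eventually_elim
      case (elim z)
      then show ?case using normal_density_pos[OF assms, of m z] by (auto simp: ennreal_eq_0_iff)
    qed
    then have "{x<..y} \<in> null_sets lborel" by (subst AE_iff_null_sets) auto
    then have "emeasure lborel {x<..y} = 0" by (simp only: null_sets_def mem_Collect_eq)
    then show False using \<open>x < y\<close> by simp
  qed
  then have "0 < measure ?N {x<..y}"
    using zero_less_measure_iff[of ?N "{x<..y}"] by (simp add: null_sets_def emeasure_eq_measure zero_less_measure_iff)
  then show "cdf ?N x < cdf ?N y"
    using cdf_diff_eq[OF \<open>x < y\<close>] by simp
qed

lemma path_law_brownian_motion:
  assumes T: "T > 0" and \<sigma>: "\<sigma> > 0"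
    and B: "standard_brownian_motion T M B"
    and P: "P = path_law T M (\<lambda>t \<omega>. x0 + \<sigma> * B t \<omega>)"
  shows "prob_space P" "(\<lambda>\<omega>. \<omega> T) \<in> borel_measurable P"
    "terminal_law T P = density lborel (normal_density x0 (\<sigma> * sqrt T))"
proof -
  interpret M: prob_space M using B by (simp add: standard_brownian_motion_def)
  let ?Y = "\<lambda>\<omega>. \<lambda>t\<in>{0..T}. x0 + \<sigma> * B t \<omega>"
  have meas: "B t \<in> borel_measurable M" if "t \<in> {0..T}" for t
    using B that by (auto simp: standard_brownian_motion_def)
  have cont: "continuous_on {0..T} (\<lambda>t. B t \<omega>)" if "\<omega> \<in> space M" for \<omega>
    using B that by (auto simp: standard_brownian_motion_def)
  have Y: "?Y \<in> measurable M (path_space T)"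
    unfolding path_space_def
  proof (rule measurable_restrict_space2)
    show "?Y \<in> space M \<rightarrow> {\<omega>. continuous_on {0..T} \<omega>}"
    proof
      fix \<omega> assume "\<omega> \<in> space M"
      then have "continuous_on {0..T} (\<lambda>t. x0 + \<sigma> * B t \<omega>)"
        by (intro continuous_intros cont)
      then show "?Y \<omega> \<in> {\<omega>. continuous_on {0..T} \<omega>}"
        by (auto elim!: continuous_on_cong[THEN iffD1, rotated -1])
    qed
    show "?Y \<in> measurable M (PiM {0..T} (\<lambda>_. borel))"
      by (rule measurable_restrict) (use meas in measurable)
  qed
  have ev: "(\<lambda>\<omega>. \<omega> T) \<in> borel_measurable (path_space T)"
    unfolding path_space_def using T
    by (intro measurable_restrict_space1 measurable_component_singleton) auto
  show "prob_space P" unfolding P path_law_def by (rule M.prob_space_distr[OF Y])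
  show "(\<lambda>\<omega>. \<omega> T) \<in> borel_measurable P" unfolding P path_law_def using ev by simp
  have "distributed M lborel (\<lambda>\<omega>. B T \<omega> - B 0 \<omega>) (\<lambda>x. ennreal (normal_density 0 (sqrt (T - 0)) x))"
    using B T unfolding standard_brownian_motion_def by blast
  then have "distributed M lborel (\<lambda>\<omega>. B T \<omega> - B 0 \<omega>) (normal_density 0 (sqrt T))" by simp
  then have "distributed M lborel (\<lambda>\<omega>. x0 + \<sigma> * (B T \<omega> - B 0 \<omega>)) (normal_density (x0 + \<sigma> * 0) (\<bar>\<sigma>\<bar> * sqrt T))"
    by (rule M.normal_density_affine) (use \<sigma> T in auto)
  then have "distr M lborel (\<lambda>\<omega>. x0 + \<sigma> * (B T \<omega> - B 0 \<omega>)) = density lborel (normal_density x0 (\<sigma> * sqrt T))"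
    using \<sigma> by (simp add: distributed_def)
  moreover have "terminal_law T P = distr M lborel (\<lambda>\<omega>. x0 + \<sigma> * (B T \<omega> - B 0 \<omega>))"
  proof -
    have "terminal_law T P = distr M borel (\<lambda>\<omega>. x0 + \<sigma> * B T \<omega>)"
      unfolding terminal_law_def P path_law_def using T
      by (subst distr_distr[OF ev Y]) (simp add: comp_def)
    also have "\<dots> = distr M lborel (\<lambda>\<omega>. x0 + \<sigma> * (B T \<omega> - B 0 \<omega>))"
      using B by (intro distr_cong) (auto simp: standard_brownian_motion_def)
    finally show ?thesis .
  qed
  ultimately show "terminal_law T P = density lborel (normal_density x0 (\<sigma> * sqrt T))" by simp
qed

theorem theorem5p2:
  fixes T \<sigma> c x0 \<alpha> V0 K :: real
    and M :: "'a measure" and B :: "real \<Rightarrow> 'a \<Rightarrow> real"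
    and P :: "(real \<Rightarrow> real) measure"
  assumes "T > 0" and "\<sigma> > 0" and "c > 0"
    and "standard_brownian_motion T M B"
    and "P = path_law T M (\<lambda>t \<omega>. x0 + \<sigma> * B t \<omega>)"
    and "0 < \<alpha>" and "\<alpha> < 1" and "K \<ge> V0"
  shows
    "(\<exists>!x. solves_level_equation c \<sigma> V0 K \<alpha> x) \<and>
     (\<forall>x\<alpha>. solves_level_equation c \<sigma> V0 K \<alpha> x\<alpha> \<longrightarrow>
       (let Rs = step_reward c \<sigma> V0 \<alpha> x\<alpha>;
            \<mu>s = equilibrium T c \<sigma> P Rs;
            q = quantile \<mu>s \<alpha>;
            f0 = normal_density x0 (\<sigma> * sqrt T)
        in
          Rs \<in> feasible_rewards T c \<sigma> P V0 K \<and>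
          optimal_quantile T c \<sigma> P V0 K \<alpha> = ereal q \<and>
          (\<forall>R\<in>feasible_rewards T c \<sigma> P V0 K.
             ereal (quantile (equilibrium T c \<sigma> P R) \<alpha>) = optimal_quantile T c \<sigma> P V0 K \<alpha> \<longrightarrow>
             (AE r in lborel. r \<in> {0..1} \<longrightarrow> R r = Rs r)) \<and>
          q = x0 + \<sigma> * sqrt T * inv (cdf std_normal_distribution) x\<alpha> \<and>
          \<mu>s = density lborel
            (\<lambda>x. ennreal (if x < q then \<alpha> / x\<alpha> * f0 x else (1 - \<alpha>) / (1 - x\<alpha>) * f0 x))))"
proof -
  note \<alpha> = \<open>0 < \<alpha>\<close> \<open>\<alpha> < 1\<close>
  let ?s = "\<sigma> * sqrt T"
  have s: "0 < ?s" using assms by simp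
  let ?\<nu> = "density lborel (normal_density x0 ?s)"
  interpret rank_game P T c \<sigma> ?\<nu>
  proof (intro rank_game.intro rank_game_axioms.intro)
    show "prob_space P" "(\<lambda>\<omega>. \<omega> T) \<in> borel_measurable P" "?\<nu> = terminal_law T P"
      using path_law_brownian_motion[OF assms(1,2,4,5)] by auto
  qed (use assms s in \<open>auto intro: isCont_cdf_normal strict_mono_cdf_normal\<close>)
  have "\<exists>!x. solves_level_equation c \<sigma> V0 K \<alpha> x"
    unfolding solves_level_equation_iff using \<open>K \<ge> V0\<close> \<beta>_pos
    by (intro binary_divergence_inverse[OF \<alpha>] divide_nonneg_nonneg) auto
  moreover have "quantile (equilibrium T c \<sigma> P (step_reward c \<sigma> V0 \<alpha> x)) \<alpha>
      = x0 + ?s * inv (cdf std_normal_distribution) x" (is "?q = _")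
    if x: "solves_level_equation c \<sigma> V0 K \<alpha> x" for x
  proof -
    have "cdf std_normal_distribution ((?q - x0) / ?s) = x"
      using optimal_step_reward(1)[OF \<alpha> x] cdf_normal[OF s] by simp
    moreover have "inj (cdf std_normal_distribution)"
      using strict_mono_cdf_normal[of 1 0] by (auto intro: strict_mono_imp_inj_on)
    ultimately have "inv (cdf std_normal_distribution) x = (?q - x0) / ?s"
      by (metis inv_f_f)
    then show ?thesis using \<open>T > 0\<close> \<open>\<sigma> > 0\<close> by simp
  qed
  moreover have "equilibrium T c \<sigma> P (step_reward c \<sigma> V0 \<alpha> x) = density lborel
      (\<lambda>y. ennreal (if y < quantile (equilibrium T c \<sigma> P (step_reward c \<sigma> V0 \<alpha> x)) \<alpha>
        then \<alpha> / x * normal_density x0 ?s y else (1 - \<alpha>) / (1 - x) * normal_density x0 ?s y))"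
    (is "?\<mu> = density lborel (\<lambda>y. ennreal (if y < ?q then _ y else _ y))")
    if x: "solves_level_equation c \<sigma> V0 K \<alpha> x" for x
  proof -
    have "0 \<le> \<alpha> / x" "0 \<le> (1 - \<alpha>) / (1 - x)"
      using x \<alpha> by (auto simp: solves_level_equation_iff)
    note nonneg = this
    have "?\<mu> = density ?\<nu> (\<lambda>y. ennreal (if y < ?q then \<alpha> / x else (1 - \<alpha>) / (1 - x)))"
      by (rule optimal_step_reward(4)[OF \<alpha> x])
    also have "\<dots> = density lborel (\<lambda>y. ennreal (normal_density x0 ?s y) *
        ennreal (if y < ?q then \<alpha> / x else (1 - \<alpha>) / (1 - x)))"
      by (rule density_density_eq) auto
    also have "\<dots> = density lborel (\<lambda>y. ennreal (if y < ?q then \<alpha> / x * normal_density x0 ?s y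
        else (1 - \<alpha>) / (1 - x) * normal_density x0 ?s y))"
      by (rule arg_cong[where f="density lborel"])
        (use nonneg in \<open>auto simp: fun_eq_iff ennreal_mult'[symmetric] mult.commute\<close>)
    finally show ?thesis .
  qed
  ultimately show ?thesis
    unfolding Let_def
    using optimal_step_reward(2,3)[OF \<alpha>] step_reward_feasible(1)[OF \<alpha>] by simp
qed

end
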